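(* Let $p,q\in\hat M=\mathbb R^2$. Then $[p,q]_{\min}$ is the unique minimizing path of $(\hat M,\hat F)$ connecting $p$ and $q$; that is, every piecewise smooth path $\gamma$ from $p$ to $q$ satisfies $\ell_{\hat F}([p,q]_{\min})\le \ell_{\hat F}(\gamma)$, with equality if and only if $\gamma=[p,q]_{\min}$ (paths that differ by a monotonic reparameterization being identified).
   Context: Structure. $\hat M=\mathbb R^2$ with canonical coordinates $(x^1,x^2)$ (superscripts are indices). $F_0$ is the norm on $\mathbb R^2$ whose unit sphere is the regular hexagon with vertices $\pm(0,1)$, $\pm(\sqrt3/2,1/2)$, $\pm(-\sqrt3/2,1/2)$. For $i\in\{0,\dots,11\}$ put $v_i=(\sin(\pi i/6),\cos(\pi i/6))$ (the direction of the hour hand at $i$ o'clock). $[p_1,\dots,p_n]$ denotes the concatenation of the oriented Euclidean segments $[p_1,p_2],\dots,[p_{n-1},p_n]$, and $\ell_E$ is Euclidean length. Fix $\hat\theta\in(\pi/3,\pi/2]$. For $p\in\hat M$, $A(p)$ is the set of $q\ne p$ such that the Euclidean angle between $q-p$ and $(0,1)$ is at most $\hat\theta$. Let $a,b,c,d\in\mathbb R^2$ be such that $b-a,\ c-b,\ d-c,\ a-d$ are positive multiples of $v_8,v_6,v_2,v_{10}$ respectively and $d-b$ is a positive multiple of $(\sin\hat\theta,\cos\hat\theta)$ (such a trapezoid exists and is unique up to Euclidean homothety); put $L_{\hat\theta}=\ell_E([d,a,b,c])/\ell_E([c,d])>1$. Let $f:\hat M\to\mathbb R$ be a continuous positive function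 such that $f(q)<f(p)$ whenever $q\in A(p)$, and $f(x)\in(1,L_{\hat\theta})$ for all $x\in\hat M$. Put $\hat F(x,y)=f(x)F_0(y)$ for $x\in\hat M$, $y\in T_x\hat M=\mathbb R^2$. For a piecewise smooth $\gamma:[t_0,s_0]\to\hat M$, $\ell_{\hat F}(\gamma)=\int_{t_0}^{s_0}\hat F(\gamma(t),\gamma'(t))\,dt$; $d_{\hat F}(p,q)$ is the infimum of $\ell_{\hat F}$ over piecewise smooth paths from $p$ to $q$. A minimizing path from $p$ to $q$ is a piecewise smooth path from $p$ to $q$ whose length equals $d_{\hat F}(p,q)$. The path $[p,q]_{\min}$. Let $h_i(p)=\{p+sv_i: s\ge0\}$ and $l_i(p)=\{p+sv_i:s\in\mathbb R\}$. For odd $k\in\{1,3,5,7,9,11\}$, $S_k(p)$ is the open sector of angle $\pi/3$ bounded by $h_{k-1}(p)$ and $h_{k+1}(p)$ (with $h_{12}=h_0$). Let $p\neq q$. If $q-p$ is a positive multiple of some $v_i$ with $i$ even, then $[p,q]_{\min}=[p,q]$. Otherwise $q$ lies in a unique $S_k(p)$; let $h_i(p)$ be its upper and $h_j(p)$ its lower boundary half-line, i.e. $(k,i,j)\in\{(1,0,2),(3,2,4),(5,4,6),(7,8,6),(9,10,8),(11,0,10)\}$; let $a$ be the intersection point of $l_i(p)$ and $l_j(q)$; then $[p,q]_{\min}=[p,a,q]$. Finally $[p,p]_{\min}$ is the constant path at $p$. *)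

theory Defs
  imports "HOL-Analysis.Analysis"
begin

text \<open>The plane is \<^typ>\<open>real \<times> real\<close> with the (Euclidean) library norm and inner product.\<close>

type_synonym plane = "real \<times> real"

definition pos_multiple :: "plane \<Rightarrow> plane \<Rightarrow> bool" where
  "pos_multiple u w \<longleftrightarrow> (\<exists>s>0. u = s *\<^sub>R w)"

definition hour_dir :: "nat \<Rightarrow> plane" where
  "hour_dir i = (sin (pi * real i / 6), cos (pi * real i / 6))"

definition euclidean_angle :: "plane \<Rightarrow> plane \<Rightarrow> real" where
  "euclidean_angle u w = arccos (inner u w / (norm u * norm w))"


section \<open>The hexagonal norm\<close>

definition hexagon_vertices :: "plane set" where
  "hexagon_vertices =
    {(0, 1), - (0, 1), (sqrt 3 / 2, 1 / 2), - (sqrt 3 / 2, 1 / 2),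
     (- sqrt 3 / 2, 1 / 2), - (- sqrt 3 / 2, 1 / 2)}"

text \<open>The norm with unit sphere a given hexagon is the Minkowski functional of the solid hexagon.
  The facts \<open>F0_norm\<close> and \<open>F0_unit_sphere\<close> below confirm that this is the norm with that
  unit sphere; by homogeneity a norm is determined by its unit sphere.\<close>

definition F0 :: "plane \<Rightarrow> real" where
  "F0 y = Inf {r. 0 \<le> r \<and> y \<in> (*\<^sub>R) r ` (convex hull hexagon_vertices)}"


section \<open>Piecewise smooth paths, length and distance\<close>

text \<open>\<open>C\<^sup>\<infinity>\<close> on a compact interval, with one-sided derivatives of all orders at the end points.\<close>

definition smooth_on_interval :: "(real \<Rightarrow> plane) \<Rightarrow> real \<Rightarrow> real \<Rightarrow> bool" where
  "smooth_on_interval \<gamma> u v \<longleftrightarrow>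
    (\<exists>D :: nat \<Rightarrow> real \<Rightarrow> plane.
      (\<forall>t\<in>{u..v}. D 0 t = \<gamma> t) \<and>
      (\<forall>n. \<forall>t\<in>{u..v}. (D n has_vector_derivative D (Suc n) t) (at t within {u..v})))"

text \<open>Smoothness on the closed pieces makes the path continuous. The library notion
  \<^const>\<open>piecewise_C1_differentiable_on\<close> is not suitable: it allows the derivative to be unbounded
  near a break point, and then the length integral below need not exist.\<close>

definition piecewise_smooth :: "(real \<Rightarrow> plane) \<Rightarrow> real \<Rightarrow> real \<Rightarrow> bool" where
  "piecewise_smooth \<gamma> t0 s0 \<longleftrightarrow> t0 < s0 \<and>
    (\<exists>(n::nat) \<tau>. \<tau> 0 = t0 \<and> \<tau> n = s0 \<and>
      (\<forall>i<n. \<tau> i < \<tau> (Suc i) \<and> smooth_on_interval \<gamma> (\<tau> i) (\<tau> (Suc i))))"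

definition path_from_to :: "plane \<Rightarrow> plane \<Rightarrow> (real \<Rightarrow> plane) \<Rightarrow> real \<Rightarrow> real \<Rightarrow> bool" where
  "path_from_to p q \<gamma> t0 s0 \<longleftrightarrow> piecewise_smooth \<gamma> t0 s0 \<and> \<gamma> t0 = p \<and> \<gamma> s0 = q"

text \<open>At the finitely many break points the value of \<^const>\<open>vector_derivative\<close> is irrelevant
  for the integral.\<close>

definition finsler_length ::
  "(plane \<Rightarrow> plane \<Rightarrow> real) \<Rightarrow> (real \<Rightarrow> plane) \<Rightarrow> real \<Rightarrow> real \<Rightarrow> real" where
  "finsler_length F \<gamma> t0 s0 =
    integral {t0..s0} (\<lambda>t. F (\<gamma> t) (vector_derivative \<gamma> (at t within {t0..s0})))"

definition finsler_dist :: "(plane \<Rightarrow> plane \<Rightarrow> real) \<Rightarrow> plane \<Rightarrow> plane \<Rightarrow> real" where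
  "finsler_dist F p q = Inf {finsler_length F \<gamma> t0 s0 | \<gamma> t0 s0. path_from_to p q \<gamma> t0 s0}"

definition minimizing_path ::
  "(plane \<Rightarrow> plane \<Rightarrow> real) \<Rightarrow> plane \<Rightarrow> plane \<Rightarrow> (real \<Rightarrow> plane) \<Rightarrow> real \<Rightarrow> real \<Rightarrow> bool" where
  "minimizing_path F p q \<gamma> t0 s0 \<longleftrightarrow>
    path_from_to p q \<gamma> t0 s0 \<and> finsler_length F \<gamma> t0 s0 = finsler_dist F p q"

text \<open>The parameter change is only weakly monotone, since a piecewise smooth path may rest. It is
  applied to \<open>\<sigma>\<close> only; this loses nothing when, as for \<open>min_path\<close> below, \<open>\<sigma>\<close> is injective or
  constant.\<close>

definition monotone_reparam_of ::
  "(real \<Rightarrow> plane) \<Rightarrow> real \<Rightarrow> real \<Rightarrow> (real \<Rightarrow> plane) \<Rightarrow> real \<Rightarrow> real \<Rightarrow> bool" where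
  "monotone_reparam_of \<gamma> t0 s0 \<sigma> u0 u1 \<longleftrightarrow>
    (\<exists>\<phi> :: real \<Rightarrow> real. continuous_on {t0..s0} \<phi> \<and> mono_on {t0..s0} \<phi> \<and>
      \<phi> ` {t0..s0} = {u0..u1} \<and> (\<forall>t\<in>{t0..s0}. \<gamma> t = \<sigma> (\<phi> t)))"


section \<open>The conformal factor\<close>

definition cone_above :: "real \<Rightarrow> plane \<Rightarrow> plane set" where
  "cone_above \<theta> p = {q. q \<noteq> p \<and> euclidean_angle (q - p) (0, 1) \<le> \<theta>}"

definition trapezoid :: "real \<Rightarrow> plane \<Rightarrow> plane \<Rightarrow> plane \<Rightarrow> plane \<Rightarrow> bool" where
  "trapezoid \<theta> a b c d \<longleftrightarrow>
    pos_multiple (b - a) (hour_dir 8) \<and> pos_multiple (c - b) (hour_dir 6) \<and>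
    pos_multiple (d - c) (hour_dir 2) \<and> pos_multiple (a - d) (hour_dir 10) \<and>
    pos_multiple (d - b) (sin \<theta>, cos \<theta>)"

definition euclidean_length :: "(real \<Rightarrow> plane) \<Rightarrow> real" where
  "euclidean_length \<gamma> = finsler_length (\<lambda>x y. norm y) \<gamma> 0 1"

text \<open>The number \<open>L\<^bsub>\<theta>\<^esub>\<close>, computed from a trapezoid for \<open>\<theta>\<close>.\<close>

definition trapezoid_ratio :: "plane \<Rightarrow> plane \<Rightarrow> plane \<Rightarrow> plane \<Rightarrow> real" where
  "trapezoid_ratio a b c d =
    euclidean_length (linepath d a +++ linepath a b +++ linepath b c) /
    euclidean_length (linepath c d)"

definition conformal_finsler :: "(plane \<Rightarrow> real) \<Rightarrow> plane \<Rightarrow> plane \<Rightarrow> real" where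
  "conformal_finsler f x y = f x * F0 y"


section \<open>The path \<open>[p, q]\<close> min\<close>

definition half_line :: "nat \<Rightarrow> plane \<Rightarrow> plane set" where
  "half_line i p = {p + s *\<^sub>R hour_dir i | s. 0 \<le> s}"

definition full_line :: "nat \<Rightarrow> plane \<Rightarrow> plane set" where
  "full_line i p = {p + s *\<^sub>R hour_dir i | s. True}"

text \<open>For odd \<open>k\<close>, the open sector of angle \<open>\<pi>/3\<close> bounded by \<open>half_line (k - 1) p\<close> and
  \<open>half_line (k + 1) p\<close>; note \<open>hour_dir 12 = hour_dir 0\<close>.\<close>

definition sector :: "nat \<Rightarrow> plane \<Rightarrow> plane set" where
  "sector k p = {p + s *\<^sub>R hour_dir (k - 1) + t *\<^sub>R hour_dir (k + 1) | s t. 0 < s \<and> 0 < t}"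

text \<open>Triples (sector, upper boundary half-line, lower boundary half-line).\<close>

definition sector_table :: "(nat \<times> nat \<times> nat) set" where
  "sector_table = {(1,0,2), (3,2,4), (5,4,6), (7,8,6), (9,10,8), (11,0,10)}"

definition min_path :: "plane \<Rightarrow> plane \<Rightarrow> real \<Rightarrow> plane" where
  "min_path p q =
    (if p = q \<or> (\<exists>i\<in>{0,2,4,6,8,10}. pos_multiple (q - p) (hour_dir i)) then linepath p q
     else
       let (k, i, j) = (THE (k, i, j). (k, i, j) \<in> sector_table \<and> q \<in> sector k p);
           a = (THE a. a \<in> full_line i p \<and> a \<in> full_line j q)
       in linepath p a +++ linepath a q)"


section \<open>The hexagonal norm has the prescribed unit sphere\<close>

definition hexN :: "plane \<Rightarrow> real" where
  "hexN y = max (2 / sqrt 3 * \<bar>fst y\<bar>) (\<bar>snd y\<bar> + \<bar>fst y\<bar> / sqrt 3)"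

lemma hexN_scale: "hexN (r *\<^sub>R y) = \<bar>r\<bar> * hexN y"
  unfolding hexN_def
  by (simp add: abs_mult max_mult_distrib_left distrib_left mult.left_commute)

lemma hexN_triangle: "hexN (x + y) \<le> hexN x + hexN y"
proof -
  have 1: "\<bar>fst x + fst y\<bar> \<le> \<bar>fst x\<bar> + \<bar>fst y\<bar>" "\<bar>snd x + snd y\<bar> \<le> \<bar>snd x\<bar> + \<bar>snd y\<bar>"
    by simp_all
  have 2: "2 / sqrt 3 * \<bar>fst x + fst y\<bar> \<le> 2 / sqrt 3 * \<bar>fst x\<bar> + 2 / sqrt 3 * \<bar>fst y\<bar>"
    unfolding distrib_left[symmetric] by (rule mult_left_mono[OF 1(1)]) simp
  have 3: "\<bar>fst x + fst y\<bar> / sqrt 3 \<le> \<bar>fst x\<bar> / sqrt 3 + \<bar>fst y\<bar> / sqrt 3"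
    unfolding add_divide_distrib[symmetric] by (rule divide_right_mono[OF 1(1)]) simp
  have m: "a \<le> a' + a'' \<Longrightarrow> b \<le> b' + b'' \<Longrightarrow> max a b \<le> max a' b' + max a'' b''"
    for a a' a'' b b' b'' :: real
    by (intro max.boundedI) (auto intro: order_trans add_mono)
  have 4: "\<bar>snd x + snd y\<bar> + \<bar>fst x + fst y\<bar> / sqrt 3
      \<le> (\<bar>snd x\<bar> + \<bar>fst x\<bar> / sqrt 3) + (\<bar>snd y\<bar> + \<bar>fst y\<bar> / sqrt 3)"
    using add_mono[OF 1(2) 3] by (simp only: ac_simps)
  show ?thesis unfolding hexN_def fst_add snd_add by (rule m[OF 2 4])
qed

lemma hexN_nonneg: "0 \<le> hexN y"
  by (simp add: hexN_def le_max_iff_disj)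

lemma hexN_eq_0: "hexN y = 0 \<longleftrightarrow> y = 0"
proof
  assume "hexN y = 0"
  then have a: "2 / sqrt 3 * \<bar>fst y\<bar> \<le> 0" "\<bar>snd y\<bar> + \<bar>fst y\<bar> / sqrt 3 \<le> 0"
    using max.cobounded1 max.cobounded2 unfolding hexN_def by metis+
  from a(1) have "fst y = 0" by (simp add: mult_le_0_iff divide_le_0_iff)
  with a(2) show "y = 0" by (simp add: prod_eq_iff)
qed (simp add: hexN_def)

lemma hexagon_eq: "convex hull hexagon_vertices = {y. hexN y \<le> 1}"
proof
  show "convex hull hexagon_vertices \<subseteq> {y. hexN y \<le> 1}"
  proof (rule hull_minimal)
    show "hexagon_vertices \<subseteq> {y. hexN y \<le> 1}"
      by (auto simp: hexagon_vertices_def hexN_def)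
    show "convex {y. hexN y \<le> 1}"
    proof (rule convexI, clarify)
      fix x y :: plane and u v :: real
      assume h: "hexN x \<le> 1" "hexN y \<le> 1" "0 \<le> u" "0 \<le> v" "u + v = 1"
      have "hexN (u *\<^sub>R x + v *\<^sub>R y) \<le> u * hexN x + v * hexN y"
        using hexN_triangle[of "u *\<^sub>R x" "v *\<^sub>R y"] h by (simp add: hexN_scale)
      also have "\<dots> \<le> u * 1 + v * 1" using h by (intro add_mono mult_left_mono) auto
      finally show "hexN (u *\<^sub>R x + v *\<^sub>R y) \<le> 1" using h by simp
    qed
  qed
  show "{y. hexN y \<le> 1} \<subseteq> convex hull hexagon_vertices"
  proof clarify
    fix x y :: real
    assume h: "hexN (x, y) \<le> 1"
    let ?K = "convex hull hexagon_vertices"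
    define w where "w = \<bar>x\<bar> / (sqrt 3 / 2)"
    define e where "e = (if x < 0 then -1 else (1::real))"
    have h1: "2 / sqrt 3 * \<bar>x\<bar> \<le> 1" and h2: "\<bar>y\<bar> + \<bar>x\<bar> / sqrt 3 \<le> 1"
      using h by (simp_all add: hexN_def)
    have w: "0 \<le> w" "w \<le> 1" using h1 by (simp_all add: w_def mult.commute)
    have x: "x = w * (e * sqrt 3 / 2)" by (simp add: w_def e_def)
    have y: "\<bar>y\<bar> \<le> 1 - w / 2" using h2 by (simp add: w_def)
    have V: "(e * sqrt 3 / 2, 1 / 2) \<in> ?K" "(e * sqrt 3 / 2, - 1 / 2) \<in> ?K"
        "(0, 1) \<in> ?K" "(0, -1) \<in> ?K"
      by (rule hull_inc, simp add: hexagon_vertices_def e_def)+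
    have cK: "convex ?K" by (rule convex_convex_hull)
    have top: "(x, 1 - w / 2) \<in> ?K"
      using convexD[OF cK V(1) V(3), of w "1 - w"] w by (simp add: x)
    have bot: "(x, - (1 - w / 2)) \<in> ?K"
      using convexD[OF cK V(2) V(4), of w "1 - w"] w by (simp add: x)
    define H where "H = 1 - w / 2"
    have H: "0 < H" "\<bar>y\<bar> \<le> H" using w y by (simp_all add: H_def)
    have "((H + y) / (2 * H)) *\<^sub>R (x, H) + ((H - y) / (2 * H)) *\<^sub>R (x, - H) \<in> ?K"
      using H top bot by (intro convexD[OF cK]) (auto simp: H_def[symmetric] field_simps)
    moreover have "((H + y) / (2 * H)) *\<^sub>R (x, H) + ((H - y) / (2 * H)) *\<^sub>R (x, - H) = (x, y)"
      using H by (simp add: field_simps)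
    ultimately show "(x, y) \<in> ?K" by simp
  qed
qed

lemma F0_eq: "F0 y = max (2 / sqrt 3 * \<bar>fst y\<bar>) (\<bar>snd y\<bar> + \<bar>fst y\<bar> / sqrt 3)"
proof -
  have "{r. 0 \<le> r \<and> y \<in> (*\<^sub>R) r ` (convex hull hexagon_vertices)} = {hexN y..}"
  proof (intro set_eqI iffI)
    fix r assume "r \<in> {r. 0 \<le> r \<and> y \<in> (*\<^sub>R) r ` (convex hull hexagon_vertices)}"
    then obtain z where "0 \<le> r" "y = r *\<^sub>R z" "hexN z \<le> 1" by (auto simp: hexagon_eq)
    then show "r \<in> {hexN y..}" by (simp add: hexN_scale mult_left_le)
  next
    fix r assume "r \<in> {hexN y..}"
    then have r: "hexN y \<le> r" "0 \<le> r" using hexN_nonneg[of y] by auto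
    show "r \<in> {r. 0 \<le> r \<and> y \<in> (*\<^sub>R) r ` (convex hull hexagon_vertices)}"
    proof (cases "r = 0")
      case True
      then have "y = 0" using r hexN_nonneg[of y] hexN_eq_0[of y] by auto
      then have "y = r *\<^sub>R 0" "hexN 0 \<le> 1" by (auto simp: hexN_def)
      then show ?thesis using r by (auto simp: hexagon_eq)
    next
      case False
      then have "y = r *\<^sub>R (inverse r *\<^sub>R y)" by simp
      moreover have "hexN (inverse r *\<^sub>R y) \<le> 1"
        using False r by (simp add: hexN_scale field_simps)
      ultimately have "y \<in> (*\<^sub>R) r ` {y. hexN y \<le> 1}" by (metis image_eqI mem_Collect_eq)
      then show ?thesis using r by (simp add: hexagon_eq)
    qed
  qed
  then show ?thesis by (simp add: F0_def hexN_def)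
qed

lemma F0_norm:
  "0 \<le> F0 y" "F0 y = 0 \<longleftrightarrow> y = 0" "F0 (r *\<^sub>R y) = \<bar>r\<bar> * F0 y" "F0 (x + y) \<le> F0 x + F0 y"
proof -
  have "F0 = hexN" by (simp add: fun_eq_iff F0_eq hexN_def)
  then show "0 \<le> F0 y" "F0 y = 0 \<longleftrightarrow> y = 0" "F0 (r *\<^sub>R y) = \<bar>r\<bar> * F0 y"
    "F0 (x + y) \<le> F0 x + F0 y"
    by (simp_all only: hexN_nonneg hexN_eq_0 hexN_scale hexN_triangle)
qed

lemma F0_unit_sphere: "{y. F0 y = 1} = frontier (convex hull hexagon_vertices)"
proof -
  have F: "F0 = hexN" by (simp add: fun_eq_iff F0_eq hexN_def)
  have c: "continuous_on UNIV hexN" unfolding hexN_def by (intro continuous_intros) auto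
  have cl: "closed {y. hexN y \<le> 1}" by (intro closed_Collect_le c continuous_intros)
  have op: "open {y. hexN y < 1}" by (intro open_Collect_less c continuous_intros)
  have "interior {y. hexN y \<le> 1} = {y. hexN y < 1}"
  proof
    show "{y. hexN y < 1} \<subseteq> interior {y. hexN y \<le> 1}"
      by (rule interior_maximal) (use op in auto)
    show "interior {y. hexN y \<le> 1} \<subseteq> {y. hexN y < 1}"
    proof
      fix y assume y: "y \<in> interior {y. hexN y \<le> 1}"
      then obtain e where e: "0 < e" "ball y e \<subseteq> {y. hexN y \<le> 1}" by (auto simp: mem_interior)
      define s where "s = e / (2 * (norm y + 1))"
      have s: "0 < s" using e by (simp add: s_def add_nonneg_pos)
      have "s * norm y < e"
      proof -
        have "s * norm y \<le> s * (norm y + 1)" using s by simp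
        also have "\<dots> = e / 2"
          using add_nonneg_pos[OF norm_ge_zero[of y], of 1] by (simp add: s_def field_simps)
        finally show ?thesis using e by simp
      qed
      then have "(1 + s) *\<^sub>R y \<in> ball y e" using s by (simp add: dist_norm scaleR_left_distrib)
      then have "(1 + s) * hexN y \<le> 1" using e s by (auto simp: hexN_scale)
      then have "hexN y \<le> 1 - s * hexN y" by (simp add: algebra_simps)
      moreover have "0 < s * hexN y" if "hexN y \<noteq> 0"
        by (rule mult_pos_pos[OF s]) (use that hexN_nonneg[of y] in simp)
      ultimately show "y \<in> {y. hexN y < 1}" by (cases "hexN y = 0") simp_all
    qed
  qed
  then show ?thesis
    unfolding frontier_def hexagon_eq closure_closed[OF cl] F
    by (simp only: set_eq_iff Diff_iff mem_Collect_eq not_less) (simp add: order_eq_iff)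
qed

end

(* Write v_i for the hexagon directions. Since f decreases upwards, the length of a two-segment
   path drops when the upper of the two directions is taken first; and since f lies between 1 and
   L = 1 + 1/k, a detour that shifts a segment upwards by h saves less than h: f at a point shifted
   by h v_0 dominates f at the point shifted by k h v_2 along the segment, so the saving is at most
   the oscillation of f over length k h, that is k h (L - 1) = h. It follows that the length u of
   the two-segment path from p grows by at most the length of any segment in a hexagon direction,
   with equality only if the longer path continues the shorter one. So u is locally Lipschitz with
   respect to f F0, which gives u(q) <= length for every path, while the strict cases give the
   strict triangle inequality off the path and hence uniqueness. *)
theory Submission
  imports Defs
begin

section \<open>Lengths of segments\<close>

text \<open>The overview's \<open>k\<close> is the ratio of the edge \<open>[c, d]\<close> to the
  edge \<open>[b, c]\<close> of the trapezoid. The triangle \<open>c\<close>, \<open>b\<close>,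
  \<open>d\<close> shows that \<open>k *\<^sub>R ur\<close> is \<open>up\<close> plus a vector along
  the diagonal from \<open>b\<close> to \<open>d\<close>, which lies on the boundary of the cone
  where \<open>f\<close> decreases; this is the origin of the comparison between the two shifted
  points. All lengths are sums of \<open>seg_length\<close>, which is the conformal length of a
  segment because \<open>F0\<close> equals 1 on the hexagon directions. Since \<open>f\<close> is
  merely continuous, the growth of the distance function is estimated by finite steps inside one
  closed sector rather than by derivatives, and is carried over sector boundaries and along
  arbitrary paths by bisection. For uniqueness the equality case has to survive this subdivision: it
  is recorded as a relation \<open>on_bent\<close> between end points, which is transitive. Three
  sectors are treated by hand; reflection in the vertical axis gives the other three.\<close>

definition seg_length :: "(plane \<Rightarrow> real) \<Rightarrow> plane \<Rightarrow> plane \<Rightarrow> real \<Rightarrow> real" where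
  "seg_length f z v h = integral {0..h} (\<lambda>t. f (z + t *\<^sub>R v))"

lemma continuous_on_along_line:
  fixes f :: "plane \<Rightarrow> real"
  assumes "continuous_on UNIV f"
  shows "continuous_on S (\<lambda>t::real. f (z + t *\<^sub>R v))"
  by (rule continuous_on_compose2[OF assms]) (auto intro!: continuous_intros)

lemma seg_integrable:
  fixes f :: "plane \<Rightarrow> real"
  assumes "continuous_on UNIV f"
  shows "(\<lambda>t. f (z + t *\<^sub>R v)) integrable_on {x..y::real}"
  by (rule integrable_continuous_interval[OF continuous_on_along_line[OF assms]])

lemma seg_length_0 [simp]: "seg_length f z v 0 = 0"
  by (simp add: seg_length_def)

lemma seg_length_add:
  assumes f: "continuous_on UNIV f" and "0 \<le> h" "0 \<le> k"
  shows "seg_length f z v (h + k) = seg_length f z v h + seg_length f (z + h *\<^sub>R v) v k"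
proof -
  have "seg_length f z v (h + k) = seg_length f z v h + integral {h..h+k} (\<lambda>t. f (z + t *\<^sub>R v))"
    unfolding seg_length_def
    using Henstock_Kurzweil_Integration.integral_combine[of 0 h "h + k" "\<lambda>t. f (z + t *\<^sub>R v)"]
      seg_integrable[OF f] assms by auto
  also have "integral {h..h+k} (\<lambda>t. f (z + t *\<^sub>R v)) = seg_length f (z + h *\<^sub>R v) v k"
    using integral_shift_real_ivl[of h h "h + k" "\<lambda>t. f (z + t *\<^sub>R v)"]
    by (simp add: seg_length_def algebra_simps)
  finally show ?thesis .
qed

lemma seg_length_mono:
  assumes f: "continuous_on UNIV f"
    and "\<And>t. 0 \<le> t \<Longrightarrow> t \<le> h \<Longrightarrow> f (z + t *\<^sub>R v) \<le> f (y + t *\<^sub>R w)"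
  shows "seg_length f z v h \<le> seg_length f y w h"
  unfolding seg_length_def by (rule integral_le) (use assms seg_integrable in auto)

lemma seg_length_strict_mono:
  assumes f: "continuous_on UNIV f" and h: "0 < h"
    and le: "\<And>t. 0 < t \<Longrightarrow> t < h \<Longrightarrow> f (z + t *\<^sub>R v) < f (y + t *\<^sub>R w)"
  shows "seg_length f z v h < seg_length f y w h"
  unfolding seg_length_def
proof (rule integral_less_real)
  show "continuous_on {0..h} (\<lambda>t. f (z + t *\<^sub>R v))" "continuous_on {0..h} (\<lambda>t. f (y + t *\<^sub>R w))"
    by (rule continuous_on_along_line[OF f])+
qed (use h le in auto)

lemma seg_length_greater:
  assumes f: "continuous_on UNIV f" and h: "0 < h" and g: "\<And>z. m < f z"
  shows "m * h < seg_length f z v h"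
proof -
  have "integral {0..h} (\<lambda>t. m) < seg_length f z v h" unfolding seg_length_def
    by (rule integral_less_real) (use h g continuous_on_along_line[OF f] in auto)
  then show ?thesis using h by (simp add: mult.commute)
qed

lemma seg_length_less:
  assumes f: "continuous_on UNIV f" and h: "0 < h" and g: "\<And>z. f z < m"
  shows "seg_length f z v h < m * h"
proof -
  have "seg_length f z v h < integral {0..h} (\<lambda>t. m)" unfolding seg_length_def
    by (rule integral_less_real) (use h g continuous_on_along_line[OF f] in auto)
  then show ?thesis using h by (simp add: mult.commute)
qed

lemma seg_length_le:
  assumes f: "continuous_on UNIV f" and h: "0 \<le> h"
    and g: "\<And>t. 0 \<le> t \<Longrightarrow> t \<le> h \<Longrightarrow> f (z + t *\<^sub>R v) \<le> m"
  shows "seg_length f z v h \<le> m * h"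
proof -
  have "seg_length f z v h \<le> integral {0..h} (\<lambda>t. m)" unfolding seg_length_def
    by (rule integral_le) (use h g seg_integrable[OF f] in auto)
  then show ?thesis using h by (simp add: mult.commute)
qed

text \<open>The properties of \<open>f\<close> that make a path along \<open>v\<close> and then
  \<open>w\<close> beat its competitors. The first clause says that \<open>v\<close> is the upper
  direction. The other two concern a path whose first leg is cut by \<open>h\<close>, with
  \<open>z\<close> as new corner: when \<open>f > 1\<close>, the removed piece costs more than
  \<open>h\<close>, and this has to pay for the changed second leg. The end point moves by
  \<open>- h\<close> times \<open>v\<close> in one case and by \<open>h\<close> times
  \<open>w - v\<close> in the other.\<close>

definition good_pair :: "(plane \<Rightarrow> real) \<Rightarrow> plane \<Rightarrow> plane \<Rightarrow> bool" where
  "good_pair f v w \<longleftrightarrow>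
    (\<forall>z h. 0 < h \<longrightarrow> f (z + h *\<^sub>R (v - w)) < f z) \<and>
    (\<forall>z h t. 0 < h \<longrightarrow> 0 \<le> t \<longrightarrow>
      seg_length f z w t < h + seg_length f (z + h *\<^sub>R v) w t \<and>
      seg_length f z w (t + h) < h + seg_length f (z + h *\<^sub>R v) w t
        + seg_length f (z + h *\<^sub>R v + t *\<^sub>R w) (w - v) h)"

text \<open>Since \<open>f\<close> oscillates by less than \<open>1 / c\<close>, displacing a segment along itself by \<open>c * h\<close>
  shortens it by less than \<open>h\<close>.\<close>

lemma shift_loss:
  assumes f: "continuous_on UNIV f" and rng: "\<And>z. 1 < f z" "\<And>z. f z < 1 + 1 / c"
    and c: "0 < c" and h: "0 < h" and t: "0 \<le> t"
    and shift: "(\<forall>s. f (z + s *\<^sub>R w + (c * h) *\<^sub>R w) \<le> f (y + s *\<^sub>R w)) \<or>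
      (\<forall>s. f (z + s *\<^sub>R w - (c * h) *\<^sub>R w) \<le> f (y + s *\<^sub>R w))"
  shows "seg_length f z w t < h + seg_length f y w t"
proof -
  have ch: "0 < c * h" and chh: "(1 + 1 / c) * (c * h) = 1 * (c * h) + h"
    using c h by (simp_all add: field_simps)
  have loss: "seg_length f x w (c * h) < seg_length f x' w (c * h) + h" for x x'
    using seg_length_less[OF f ch rng(2), of x w] seg_length_greater[OF f ch rng(1), of x' w] chh
    by linarith
  from shift show ?thesis
  proof
    assume s: "\<forall>s. f (z + s *\<^sub>R w + (c * h) *\<^sub>R w) \<le> f (y + s *\<^sub>R w)"
    have "seg_length f (z + (c * h) *\<^sub>R w) w t \<le> seg_length f y w t"
      by (rule seg_length_mono[OF f]) (use s in \<open>simp add: algebra_simps\<close>)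
    \<comment> \<open>Both sides measure the segment of parameter length \<open>c * h + t\<close>
      from \<open>z\<close>, cut at two different places. Sliding therefore changes only the two end
      pieces of length \<open>c * h\<close>, which \<open>loss\<close> compares.\<close>
    moreover have "seg_length f z w (c * h) + seg_length f (z + (c * h) *\<^sub>R w) w t =
        seg_length f z w t + seg_length f (z + t *\<^sub>R w) w (c * h)"
      using seg_length_add[OF f, of "c * h" t z w] seg_length_add[OF f, of t "c * h" z w] ch t
      by (simp add: add.commute)
    ultimately show ?thesis using loss[of z "z + t *\<^sub>R w"] by linarith
  next
    assume s: "\<forall>s. f (z + s *\<^sub>R w - (c * h) *\<^sub>R w) \<le> f (y + s *\<^sub>R w)"
    let ?x = "z - (c * h) *\<^sub>R w"
    have "seg_length f ?x w t \<le> seg_length f y w t"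
      by (rule seg_length_mono[OF f]) (use s in \<open>simp add: algebra_simps\<close>)
    moreover have "seg_length f ?x w (c * h) + seg_length f z w t =
        seg_length f ?x w t + seg_length f (?x + t *\<^sub>R w) w (c * h)"
      using seg_length_add[OF f, of "c * h" t ?x w] seg_length_add[OF f, of t "c * h" ?x w] ch t
      by (simp add: add.commute)
    ultimately show ?thesis using loss[of "?x + t *\<^sub>R w" ?x] by linarith
  qed
qed

text \<open>In the application \<open>a\<close> is \<open>up\<close>, \<open>b\<close> is
  \<open>ur\<close> and \<open>c\<close> is the \<open>k\<close> of the overview. The assumptions
  are symmetric under exchanging \<open>b\<close> and \<open>a - b\<close>, which is then the
  reflection in the vertical axis; \<open>mirror\<close> exploits this. The two shift assumptions
  carry the information from the trapezoid.\<close>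

locale hex_factor =
  fixes f :: "plane \<Rightarrow> real" and a b :: plane and c :: real
  assumes cont: "continuous_on UNIV f"
    and gt_1: "\<And>z. 1 < f z" and lt_c: "\<And>z. f z < 1 + 1 / c" and c_pos: "0 < c"
    and dec_a: "\<And>z h. 0 < h \<Longrightarrow> f (z + h *\<^sub>R a) < f z"
    and dec_b: "\<And>z h. 0 < h \<Longrightarrow> f (z + h *\<^sub>R b) < f z"
    and dec_ab: "\<And>z h. 0 < h \<Longrightarrow> f (z + h *\<^sub>R (a - b)) < f z"
    and shift_b: "\<And>z h. 0 < h \<Longrightarrow> f (z + (c * h) *\<^sub>R b) < f (z + h *\<^sub>R a)"
    and shift_ab: "\<And>z h. 0 < h \<Longrightarrow> f (z + (c * h) *\<^sub>R (a - b)) < f (z + h *\<^sub>R a)"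
begin

lemma mirror: "hex_factor f a (a - b) c"
  by unfold_locales
    (use cont gt_1 lt_c c_pos dec_a dec_b dec_ab shift_b shift_ab in \<open>simp_all\<close>)

lemma dec_le:
  assumes "0 \<le> h"
  shows "f (z + h *\<^sub>R a) \<le> f z" "f (z + h *\<^sub>R b) \<le> f z" "f (z + h *\<^sub>R (a - b)) \<le> f z"
  using assms dec_a[of h z] dec_b[of h z] dec_ab[of h z] by (cases "h = 0"; simp)+

text \<open>If \<open>f\<close> does not increase along \<open>v\<close>, the last clause of
  \<open>good_pair\<close> follows from the middle one with \<open>t + h\<close> for
  \<open>t\<close>: each point of the additional piece along \<open>w\<close> arises from a point of
  the segment along \<open>w - v\<close> by moving along \<open>v\<close>.\<close>

lemma good_pairI_dec:
  assumes "\<And>z h. 0 < h \<Longrightarrow> f (z + h *\<^sub>R (v - w)) < f z"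
    and v: "\<And>z h. 0 \<le> h \<Longrightarrow> f (z + h *\<^sub>R v) \<le> f z"
    and K: "\<And>z h t. 0 < h \<Longrightarrow> 0 \<le> t \<Longrightarrow>
      seg_length f z w t < h + seg_length f (z + h *\<^sub>R v) w t"
  shows "good_pair f v w"
  unfolding good_pair_def
proof (intro conjI allI impI assms)
  fix z and h t :: real assume h: "0 < h" and t: "0 \<le> t"
  let ?q = "z + h *\<^sub>R v + t *\<^sub>R w"
  have "seg_length f z w (t + h) < h + seg_length f (z + h *\<^sub>R v) w (t + h)"
    using K h t by simp
  also have "seg_length f (z + h *\<^sub>R v) w (t + h) = seg_length f (z + h *\<^sub>R v) w t + seg_length f ?q w h"
    using seg_length_add[OF cont] h t by simp
  also have "seg_length f ?q w h \<le> seg_length f ?q (w - v) h"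
  proof (rule seg_length_mono[OF cont])
    fix r :: real assume "0 \<le> r"
    then show "f (?q + r *\<^sub>R w) \<le> f (?q + r *\<^sub>R (w - v))"
      using v[of r "?q + r *\<^sub>R (w - v)"] by (simp add: algebra_simps)
  qed
  finally show "seg_length f z w (t + h) < h + seg_length f (z + h *\<^sub>R v) w t
        + seg_length f ?q (w - v) h" by simp
qed

lemma good_pair_1: "good_pair f a b"
proof (rule good_pairI_dec)
  fix z and h t :: real assume h: "0 < h" and t: "0 \<le> t"
  show "seg_length f z b t < h + seg_length f (z + h *\<^sub>R a) b t"
  proof (rule shift_loss[OF cont gt_1 lt_c c_pos h t], intro disjI1 allI)
    fix s show "f (z + s *\<^sub>R b + (c * h) *\<^sub>R b) \<le> f (z + h *\<^sub>R a + s *\<^sub>R b)"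
      using shift_b[OF h, of "z + s *\<^sub>R b"] by (simp add: algebra_simps)
  qed
qed (use dec_le dec_ab in auto)

lemma good_pair_3: "good_pair f b (b - a)"
proof (rule good_pairI_dec)
  fix z and h t :: real assume h: "0 < h" and t: "0 \<le> t"
  \<comment> \<open>For \<open>a = up\<close> and \<open>b = ur\<close> the direction
    \<open>b - a\<close> points downwards, so the segment is slid backwards, along
    \<open>a - b\<close>. The shift assumption compares this with a displacement by
    \<open>h *\<^sub>R a\<close>, which lies beyond the wanted \<open>h *\<^sub>R b\<close> by
    \<open>h *\<^sub>R (a - b)\<close>, a direction in which \<open>f\<close> decreases.\<close>
  show "seg_length f z (b - a) t < h + seg_length f (z + h *\<^sub>R b) (b - a) t"
  proof (rule shift_loss[OF cont gt_1 lt_c c_pos h t], intro disjI2 allI)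
    fix s
    have "f (z + s *\<^sub>R (b - a) + (c * h) *\<^sub>R (a - b)) < f (z + s *\<^sub>R (b - a) + h *\<^sub>R a)"
      by (rule shift_ab[OF h])
    also have "\<dots> \<le> f (z + h *\<^sub>R b + s *\<^sub>R (b - a))"
      using dec_le(3)[of h "z + h *\<^sub>R b + s *\<^sub>R (b - a)"] h by (simp add: algebra_simps)
    finally show "f (z + s *\<^sub>R (b - a) - (c * h) *\<^sub>R (b - a)) \<le> f (z + h *\<^sub>R b + s *\<^sub>R (b - a))"
      by (simp add: algebra_simps)
  qed
qed (use dec_le dec_a in auto)

text \<open>Now \<open>f\<close> does not decrease along \<open>v = b - a\<close>, so
  \<open>good_pairI_dec\<close> does not apply, but displacing a segment along \<open>v\<close>
  never shortens it and the trapezoid plays no part. In the last clause the final pieces at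
  parameter \<open>r\<close> differ by \<open>(h - r) *\<^sub>R v\<close>, again a displacement
  along \<open>v\<close>.\<close>

lemma good_pair_5: "good_pair f (b - a) (- a)"
  unfolding good_pair_def
proof (intro conjI allI impI)
  fix z and h :: real assume h: "0 < h"
  then show "f (z + h *\<^sub>R (b - a - - a)) < f z" using dec_b by simp
next
  fix z and h t :: real assume h: "0 < h" and t: "0 \<le> t"
  let ?v = "b - a" and ?w = "- a"
  have inc: "f z \<le> f (z + r *\<^sub>R (b - a))" if "0 \<le> r" for r z
    using dec_le(3)[OF that, of "z + r *\<^sub>R (b - a)"] by (simp add: algebra_simps)
  have le: "seg_length f z ?w t \<le> seg_length f (z + h *\<^sub>R ?v) ?w t"
  proof (rule seg_length_mono[OF cont])
    fix r show "f (z + r *\<^sub>R ?w) \<le> f (z + h *\<^sub>R ?v + r *\<^sub>R ?w)"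
      using inc[of h "z + r *\<^sub>R ?w"] h by (simp add: algebra_simps)
  qed
  then show "seg_length f z ?w t < h + seg_length f (z + h *\<^sub>R ?v) ?w t" using h by simp
  have "seg_length f z ?w (t + h) = seg_length f z ?w t + seg_length f (z + t *\<^sub>R ?w) ?w h"
    using seg_length_add[OF cont] h t by simp
  also have "seg_length f (z + t *\<^sub>R ?w) ?w h \<le> seg_length f (z + h *\<^sub>R ?v + t *\<^sub>R ?w) (?w - ?v) h"
  proof (rule seg_length_mono[OF cont])
    fix r assume "r \<le> h"
    then show "f (z + t *\<^sub>R ?w + r *\<^sub>R ?w) \<le> f (z + h *\<^sub>R ?v + t *\<^sub>R ?w + r *\<^sub>R (?w - ?v))"
      using inc[of "h - r" "z + t *\<^sub>R ?w + r *\<^sub>R ?w"] by (simp add: algebra_simps)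
  qed
  finally show "seg_length f z ?w (t + h) < h + seg_length f (z + h *\<^sub>R ?v) ?w t
        + seg_length f (z + h *\<^sub>R ?v + t *\<^sub>R ?w) (?w - ?v) h"
    using le h by simp
qed

end

section \<open>Two-segment paths\<close>

definition bent_length :: "(plane \<Rightarrow> real) \<Rightarrow> plane \<Rightarrow> plane \<Rightarrow> plane \<Rightarrow> real \<Rightarrow> real \<Rightarrow> real" where
  "bent_length f p v w s t = seg_length f p v s + seg_length f (p + s *\<^sub>R v) w t"

lemma bent_length_second:
  assumes "continuous_on UNIV f" "0 \<le> t" "0 \<le> h"
  shows "bent_length f p v w s (t + h)
    = bent_length f p v w s t + seg_length f (p + s *\<^sub>R v + t *\<^sub>R w) w h"
  using seg_length_add[OF assms] by (simp add: bent_length_def)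

text \<open>These are the two routes along the sides of a parallelogram. At equal parameters the
  point on the first route is the point on the second plus a nonnegative multiple of
  \<open>v - w\<close>, positive away from the ends. The case distinction only decides which route
  turns first; each case compares three consecutive pieces.\<close>

lemma good_pair_swap:
  assumes "good_pair f v w" and f: "continuous_on UNIV f" and "0 < h" "0 < t"
  shows "bent_length f p v w h t < bent_length f p w v t h"
proof -
  have dec: "f (z + h *\<^sub>R v - h *\<^sub>R w) < f z" if "0 < h" for z h
    using assms(1) that unfolding good_pair_def by (metis scaleR_diff_right add_diff_eq)
  have dec': "f (x + h *\<^sub>R v) < f (x + h *\<^sub>R w)" if "0 < h" for x h
    using dec[OF that, of "x + h *\<^sub>R w"] by simp
  show ?thesis
  proof (cases "h \<le> t")
    case True
    have 1: "seg_length f p v h < seg_length f p w h"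
      by (rule seg_length_strict_mono[OF f \<open>0 < h\<close>]) (use dec' in auto)
    have 2: "seg_length f (p + h *\<^sub>R v) w (t - h) \<le> seg_length f (p + h *\<^sub>R w) w (t - h)"
    proof (rule seg_length_mono[OF f])
      fix r show "f (p + h *\<^sub>R v + r *\<^sub>R w) \<le> f (p + h *\<^sub>R w + r *\<^sub>R w)"
        using dec'[OF \<open>0 < h\<close>, of "p + r *\<^sub>R w"] by (simp add: algebra_simps)
    qed
    have 3: "seg_length f (p + h *\<^sub>R v + (t - h) *\<^sub>R w) w h < seg_length f (p + t *\<^sub>R w) v h"
    proof (rule seg_length_strict_mono[OF f \<open>0 < h\<close>])
      fix r assume "r < h"
      then show "f (p + h *\<^sub>R v + (t - h) *\<^sub>R w + r *\<^sub>R w) < f (p + t *\<^sub>R w + r *\<^sub>R v)"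
        using dec'[of "h - r" "p + r *\<^sub>R v + (t - h) *\<^sub>R w + r *\<^sub>R w"] by (simp add: algebra_simps)
    qed
    have 4: "seg_length f p w t = seg_length f p w h + seg_length f (p + h *\<^sub>R w) w (t - h)"
      using seg_length_add[OF f, of h "t - h" p w] True \<open>0 < h\<close> by simp
    have 5: "seg_length f (p + h *\<^sub>R v) w t = seg_length f (p + h *\<^sub>R v) w (t - h)
        + seg_length f (p + h *\<^sub>R v + (t - h) *\<^sub>R w) w h"
      using seg_length_add[OF f, of "t - h" h "p + h *\<^sub>R v" w] True \<open>0 < h\<close> by simp
    show ?thesis unfolding bent_length_def using 1 2 3 4 5 by linarith
  next
    case False
    then have th: "t \<le> h" by simp
    have 1: "seg_length f p v t < seg_length f p w t"
      by (rule seg_length_strict_mono[OF f \<open>0 < t\<close>]) (use dec' in auto)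
    have 2: "seg_length f (p + t *\<^sub>R v) v (h - t) \<le> seg_length f (p + t *\<^sub>R w) v (h - t)"
    proof (rule seg_length_mono[OF f])
      fix r show "f (p + t *\<^sub>R v + r *\<^sub>R v) \<le> f (p + t *\<^sub>R w + r *\<^sub>R v)"
        using dec'[OF \<open>0 < t\<close>, of "p + r *\<^sub>R v"] by (simp add: algebra_simps)
    qed
    have 3: "seg_length f (p + h *\<^sub>R v) w t < seg_length f (p + t *\<^sub>R w + (h - t) *\<^sub>R v) v t"
    proof (rule seg_length_strict_mono[OF f \<open>0 < t\<close>])
      fix r assume "r < t"
      then show "f (p + h *\<^sub>R v + r *\<^sub>R w) < f (p + t *\<^sub>R w + (h - t) *\<^sub>R v + r *\<^sub>R v)"
        using dec'[of "t - r" "p + r *\<^sub>R w + (h - t) *\<^sub>R v + r *\<^sub>R v"] by (simp add: algebra_simps)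
    qed
    have 4: "seg_length f p v h = seg_length f p v t + seg_length f (p + t *\<^sub>R v) v (h - t)"
      using seg_length_add[OF f, of t "h - t" p v] th \<open>0 < t\<close> by simp
    have 5: "seg_length f (p + t *\<^sub>R w) v h = seg_length f (p + t *\<^sub>R w) v (h - t)
        + seg_length f (p + t *\<^sub>R w + (h - t) *\<^sub>R v) v t"
      using seg_length_add[OF f, of "h - t" t "p + t *\<^sub>R w" v] th \<open>0 < t\<close> by simp
    show ?thesis unfolding bent_length_def using 1 2 3 4 5 by linarith
  qed
qed

text \<open>The old path followed by a step along \<open>v\<close> ends with \<open>w\<close> before
  \<open>v\<close>; exchanging these two legs gives the new path and is a strict gain. If
  \<open>t = 0\<close> there is nothing to exchange and the step just prolongs the path.\<close>

lemma bent_length_first: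
  assumes "good_pair f v w" and f: "continuous_on UNIV f" and "0 \<le> s" "0 \<le> t" "0 < h"
  shows "bent_length f p v w (s + h) t \<le>
      bent_length f p v w s t + seg_length f (p + s *\<^sub>R v + t *\<^sub>R w) v h"
    and "0 < t \<Longrightarrow> bent_length f p v w (s + h) t <
      bent_length f p v w s t + seg_length f (p + s *\<^sub>R v + t *\<^sub>R w) v h"
proof -
  have 1: "seg_length f p v (s + h) = seg_length f p v s + seg_length f (p + s *\<^sub>R v) v h"
    using seg_length_add[OF f] assms by simp
  show *: "bent_length f p v w (s + h) t <
      bent_length f p v w s t + seg_length f (p + s *\<^sub>R v + t *\<^sub>R w) v h" if "0 < t"
    using good_pair_swap[OF assms(1) f \<open>0 < h\<close> that, of "p + s *\<^sub>R v"] 1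
    unfolding bent_length_def by (simp add: algebra_simps)
  show "bent_length f p v w (s + h) t \<le>
      bent_length f p v w s t + seg_length f (p + s *\<^sub>R v + t *\<^sub>R w) v h"
    using * 1 \<open>0 \<le> t\<close> by (cases "t = 0") (auto simp: bent_length_def)
qed

text \<open>None of these four steps prolongs the path, hence the strict inequalities. Where the
  first leg is cut, its removed piece pays for the changed second leg through
  \<open>good_pair\<close>. A step along \<open>- w\<close> backtracks. For \<open>v - w\<close> a
  piece along \<open>w\<close> is replaced by one along the better direction \<open>v\<close>, so
  the new path is no longer than the old one even without the step.\<close>

lemma bent_length_other:
  assumes gp: "good_pair f v w" and f: "continuous_on UNIV f" and gt: "\<And>z. 1 < f z"
    and "0 \<le> s" "0 \<le> t" "0 < h"
  shows "h \<le> s \<Longrightarrow> bent_length f p v w (s - h) (t + h) <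
      bent_length f p v w s t + seg_length f (p + s *\<^sub>R v + t *\<^sub>R w) (w - v) h" (is "_ \<Longrightarrow> ?A")
    and "h \<le> s \<Longrightarrow> bent_length f p v w (s - h) t <
      bent_length f p v w s t + seg_length f (p + s *\<^sub>R v + t *\<^sub>R w) (- v) h" (is "_ \<Longrightarrow> ?B")
    and "h \<le> t \<Longrightarrow> bent_length f p v w s (t - h) <
      bent_length f p v w s t + seg_length f (p + s *\<^sub>R v + t *\<^sub>R w) (- w) h" (is "_ \<Longrightarrow> ?C")
    and "h \<le> t \<Longrightarrow> bent_length f p v w (s + h) (t - h) <
      bent_length f p v w s t + seg_length f (p + s *\<^sub>R v + t *\<^sub>R w) (v - w) h" (is "_ \<Longrightarrow> ?D")
proof -
  have pos: "h < seg_length f z u h" for z u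
    using seg_length_greater[OF f \<open>0 < h\<close> gt] by simp
  {
    assume "h \<le> s"
    let ?y = "p + (s - h) *\<^sub>R v"
    have y: "?y + h *\<^sub>R v = p + s *\<^sub>R v" by (simp add: algebra_simps)
    have 1: "seg_length f p v s = seg_length f p v (s - h) + seg_length f ?y v h"
      using seg_length_add[OF f, of "s - h" h p v] \<open>h \<le> s\<close> \<open>0 < h\<close> by simp
    have 2: "seg_length f ?y w t < h + seg_length f (p + s *\<^sub>R v) w t"
      "seg_length f ?y w (t + h) < h + seg_length f (p + s *\<^sub>R v) w t
        + seg_length f (p + s *\<^sub>R v + t *\<^sub>R w) (w - v) h"
      using gp \<open>0 < h\<close> \<open>0 \<le> t\<close> unfolding good_pair_def y[symmetric] by blast+
    show ?A ?B unfolding bent_length_def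
      using 1 2 pos[of ?y v] pos[of "p + s *\<^sub>R v + t *\<^sub>R w" "- v"] \<open>0 < h\<close> by linarith+
  }
  {
    assume "h \<le> t"
    have 1: "bent_length f p v w s t =
        bent_length f p v w s (t - h) + seg_length f (p + s *\<^sub>R v + (t - h) *\<^sub>R w) w h"
      using bent_length_second[OF f, of "t - h" h p v w s] \<open>h \<le> t\<close> \<open>0 < h\<close> by simp
    show ?C using 1 pos[of "p + s *\<^sub>R v + (t - h) *\<^sub>R w" w] pos[of "p + s *\<^sub>R v + t *\<^sub>R w" "- w"]
        \<open>0 < h\<close> by linarith
    have dec: "f (x + r *\<^sub>R v) \<le> f (x + r *\<^sub>R w)" if "0 \<le> r" for x r
    proof -
      have "f (x + r *\<^sub>R w + r *\<^sub>R (v - w)) < f (x + r *\<^sub>R w)" if "0 < r"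
        using gp that unfolding good_pair_def by blast
      then show ?thesis using that by (cases "r = 0") (auto simp: algebra_simps)
    qed
    let ?y = "p + s *\<^sub>R v"
    have 2: "seg_length f ?y v h \<le> seg_length f ?y w h"
      by (rule seg_length_mono[OF f dec])
    have 3: "seg_length f (?y + h *\<^sub>R v) w (t - h) \<le> seg_length f (?y + h *\<^sub>R w) w (t - h)"
    proof (rule seg_length_mono[OF f])
      fix r show "f (?y + h *\<^sub>R v + r *\<^sub>R w) \<le> f (?y + h *\<^sub>R w + r *\<^sub>R w)"
        using dec[of h "?y + r *\<^sub>R w"] \<open>0 < h\<close> by (simp add: algebra_simps)
    qed
    have 4: "seg_length f p v (s + h) = seg_length f p v s + seg_length f ?y v h"
      "seg_length f ?y w t = seg_length f ?y w h + seg_length f (?y + h *\<^sub>R w) w (t - h)"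
      using seg_length_add[OF f, of s h p v] seg_length_add[OF f, of h "t - h" ?y w]
        \<open>0 \<le> s\<close> \<open>0 < h\<close> \<open>h \<le> t\<close> by auto
    show ?D unfolding bent_length_def
      using 2 3 4 pos[of "p + s *\<^sub>R v + t *\<^sub>R w" "v - w"] \<open>0 < h\<close>
      by (simp add: algebra_simps)
  }
qed

section \<open>Hexagon directions\<close>

abbreviation "up \<equiv> hour_dir 0"
abbreviation "ur \<equiv> hour_dir 2"

lemma hour_dir_even:
  "up = (0, 1)" "ur = (sqrt 3 / 2, 1 / 2)" "hour_dir 4 = ur - up" "hour_dir 6 = - up"
  "hour_dir 8 = - ur" "hour_dir 10 = up - ur" "hour_dir 12 = up"
proof -
  have "pi - pi / 3 = 2 * pi / 3" "pi / 3 + pi = 4 * pi / 3" "2 * pi - pi / 3 = 5 * pi / 3" by simp_all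
  then have e: "sin (2 * pi / 3) = sqrt 3 / 2" "cos (2 * pi / 3) = - 1 / 2"
    "sin (4 * pi / 3) = - (sqrt 3 / 2)" "cos (4 * pi / 3) = - 1 / 2"
    "sin (5 * pi / 3) = - (sqrt 3 / 2)" "cos (5 * pi / 3) = 1 / 2"
    using sin_pi_minus[of "pi / 3"] cos_pi_minus[of "pi / 3"] sin_periodic_pi[of "pi / 3"]
      cos_periodic_pi[of "pi / 3"] sin_2pi_minus[of "pi / 3"] cos_2pi_minus[of "pi / 3"]
    by (simp_all add: sin_60 cos_60)
  show "up = (0, 1)" by (simp add: hour_dir_def)
  moreover show "ur = (sqrt 3 / 2, 1 / 2)" by (simp add: hour_dir_def sin_60 cos_60)
  ultimately show "hour_dir 4 = ur - up" "hour_dir 6 = - up"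
    "hour_dir 8 = - ur" "hour_dir 10 = up - ur" "hour_dir 12 = up"
    by (simp_all add: hour_dir_def e)
qed

text \<open>Coordinates in the basis \<open>up\<close>, \<open>ur\<close>. All six hexagon
  directions have coordinates -1, 0 or 1, so statements about sectors become linear arithmetic free
  of \<open>sqrt 3\<close>.\<close>

definition up_coord :: "plane \<Rightarrow> real" where "up_coord z = snd z - fst z / sqrt 3"
definition ur_coord :: "plane \<Rightarrow> real" where "ur_coord z = 2 * fst z / sqrt 3"

lemma coord_linear [simp]:
  "up_coord (x + y) = up_coord x + up_coord y" "ur_coord (x + y) = ur_coord x + ur_coord y"
  "up_coord (x - y) = up_coord x - up_coord y" "ur_coord (x - y) = ur_coord x - ur_coord y"
  "up_coord (- x) = - up_coord x" "ur_coord (- x) = - ur_coord x"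
  "up_coord (r *\<^sub>R x) = r * up_coord x" "ur_coord (r *\<^sub>R x) = r * ur_coord x"
  "up_coord up = 1" "ur_coord up = 0" "up_coord ur = 0" "ur_coord ur = 1"
  "up_coord 0 = 0" "ur_coord 0 = 0"
  by (simp_all add: up_coord_def ur_coord_def hour_dir_even algebra_simps add_divide_distrib
      diff_divide_distrib)

lemma coord_eq_iff: "x = y \<longleftrightarrow> up_coord x = up_coord y \<and> ur_coord x = ur_coord y"
  by (auto simp: up_coord_def ur_coord_def prod_eq_iff)

text \<open>Each of the three linear forms is 1 and -1 on a pair of opposite edges of the
  hexagon.\<close>

lemma F0_coord:
  "F0 z = max (max \<bar>up_coord z\<bar> \<bar>ur_coord z\<bar>) \<bar>up_coord z + ur_coord z\<bar>"
proof -
  obtain x y where z: "z = (x, y)" by fastforce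
  define u where "u = x / sqrt 3"
  have "F0 z = max (2 * \<bar>u\<bar>) (\<bar>y\<bar> + \<bar>u\<bar>)"
    unfolding F0_eq z u_def by (simp add: abs_mult)
  moreover have "up_coord z = y - u" "ur_coord z = 2 * u"
    by (simp_all add: z up_coord_def ur_coord_def u_def)
  ultimately show ?thesis by (simp add: max_def abs_if)
qed

text \<open>The first direction of each pair is the upper one.\<close>

definition hex_pairs :: "(plane \<times> plane) set" where
  "hex_pairs = {(up, ur), (ur, ur - up), (ur - up, - up), (up, up - ur), (up - ur, - ur), (- ur, - up)}"

lemma hex_pairs_coords:
  assumes "(v, w) \<in> hex_pairs"
  obtains \<sigma> \<tau> :: "plane \<Rightarrow> real" where "linear \<sigma>" "linear \<tau>"
    "\<And>z. z = \<sigma> z *\<^sub>R v + \<tau> z *\<^sub>R w" "\<And>s t. \<sigma> (s *\<^sub>R v + t *\<^sub>R w) = s"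
    "\<And>s t. \<tau> (s *\<^sub>R v + t *\<^sub>R w) = t"
proof -
  have lin: "linear (\<lambda>z. i * up_coord z + j * ur_coord z)" for i j
    by (simp add: linear_iff algebra_simps)
  have "\<exists>i j k l. (\<forall>z. z = (i * up_coord z + j * ur_coord z) *\<^sub>R v + (k * up_coord z + l * ur_coord z) *\<^sub>R w) \<and>
    i * up_coord v + j * ur_coord v = 1 \<and> i * up_coord w + j * ur_coord w = 0 \<and>
    k * up_coord v + l * ur_coord v = 0 \<and> k * up_coord w + l * ur_coord w = 1"
    (is "\<exists>i j k l. ?P v w i j k l")
  proof -
    \<comment> \<open>The four numbers are the rows of the inverse of the matrix whose columns are
      \<open>v\<close> and \<open>w\<close> in the basis \<open>up\<close>,
      \<open>ur\<close>.\<close>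
    have "?P up ur 1 0 0 1" "?P ur (ur - up) 1 1 (- 1) 0" "?P (ur - up) (- up) 0 1 (- 1) (- 1)"
      "?P up (up - ur) 1 1 0 (- 1)" "?P (up - ur) (- ur) 1 0 (- 1) (- 1)" "?P (- ur) (- up) 0 (- 1) (- 1) 0"
      by (simp_all add: coord_eq_iff)
    then show ?thesis using assms unfolding hex_pairs_def
      by (elim insertE emptyE Pair_inject) (hypsubst, blast)+
  qed
  then obtain i j k l where ijkl: "?P v w i j k l" by blast
  define \<sigma> \<tau> where "\<sigma> z = i * up_coord z + j * ur_coord z"
    and "\<tau> z = k * up_coord z + l * ur_coord z" for z
  have st: "linear \<sigma>" "linear \<tau>" unfolding \<sigma>_def \<tau>_def by (rule lin)+
  have vw: "\<sigma> v = 1" "\<sigma> w = 0" "\<tau> v = 0" "\<tau> w = 1" and z: "\<And>z. z = \<sigma> z *\<^sub>R v + \<tau> z *\<^sub>R w"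
    using ijkl unfolding \<sigma>_def \<tau>_def by blast+
  show thesis
    by (rule that[OF st z]) (use vw in \<open>simp_all add: linear_add[OF st(1)] linear_add[OF st(2)]
      linear_cmul[OF st(1)] linear_cmul[OF st(2)]\<close>)
qed

lemma hex_pairs_independent:
  assumes "(v, w) \<in> hex_pairs" "s *\<^sub>R v + t *\<^sub>R w = s' *\<^sub>R v + t' *\<^sub>R w"
  shows "s = s'" "t = t'"
  using hex_pairs_coords[OF assms(1)] assms(2) by metis+

lemma hex_pairs_cover:
  obtains v w s t where "(v, w) \<in> hex_pairs" "0 \<le> s" "0 \<le> t" "z = s *\<^sub>R v + t *\<^sub>R w"
proof -
  define m n where "m = up_coord z" and "n = ur_coord z"
  \<comment> \<open>The lines \<open>m = 0\<close>, \<open>n = 0\<close> and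
    \<open>m + n = 0\<close> are those spanned by \<open>ur\<close>, \<open>up\<close> and
    \<open>up - ur\<close>; they cut the plane into the six closed sectors.\<close>
  have "0 \<le> m \<and> 0 \<le> n \<or> m \<le> 0 \<and> 0 \<le> m + n \<or> 0 \<le> n \<and> m + n \<le> 0 \<or>
      n \<le> 0 \<and> 0 \<le> m + n \<or> 0 \<le> m \<and> m + n \<le> 0 \<or> n \<le> 0 \<and> m \<le> 0" by linarith
  then show thesis
  proof (elim disjE conjE)
    assume "0 \<le> m" "0 \<le> n"
    then show thesis by (intro that[of up ur m n]) (simp_all add: hex_pairs_def coord_eq_iff m_def n_def)
  next
    assume "m \<le> 0" "0 \<le> m + n"
    then show thesis by (intro that[of ur "ur - up" "m + n" "- m"])
      (simp_all add: hex_pairs_def coord_eq_iff m_def n_def)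
  next
    assume "0 \<le> n" "m + n \<le> 0"
    then show thesis by (intro that[of "ur - up" "- up" n "- m - n"])
      (simp_all add: hex_pairs_def coord_eq_iff m_def n_def)
  next
    assume "n \<le> 0" "0 \<le> m + n"
    then show thesis by (intro that[of up "up - ur" "m + n" "- n"])
      (simp_all add: hex_pairs_def coord_eq_iff m_def n_def)
  next
    assume "0 \<le> m" "m + n \<le> 0"
    then show thesis by (intro that[of "up - ur" "- ur" m "- m - n"])
      (simp_all add: hex_pairs_def coord_eq_iff m_def n_def)
  next
    assume "n \<le> 0" "m \<le> 0"
    then show thesis by (intro that[of "- ur" "- up" "- n" "- m"])
      (simp_all add: hex_pairs_def coord_eq_iff m_def n_def)
  qed
qed

section \<open>Hexagon rays and uniqueness of sector coordinates\<close>

definition hex_dirs :: "plane set" where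
  "hex_dirs = {up, - up, ur, - ur, up - ur, ur - up}"

lemma hex_dirs_pair:
  assumes "(v, w) \<in> hex_pairs"
  shows "hex_dirs = {v, w, w - v, - v, - w, v - w}" "v \<in> hex_dirs" "w \<in> hex_dirs"
  using assms unfolding hex_pairs_def hex_dirs_def by auto

lemma hex_ray_unique:
  assumes "e \<in> hex_dirs" "(v, w) \<in> hex_pairs" and "0 < r" "0 \<le> s" "0 \<le> t"
    and "r *\<^sub>R e = s *\<^sub>R v + t *\<^sub>R w"
  shows "s = 0 \<and> t = r \<and> w = e \<or> t = 0 \<and> s = r \<and> v = e"
proof -
  have "r * up_coord e = s * up_coord v + t * up_coord w"
    "r * ur_coord e = s * ur_coord v + t * ur_coord w"
    using arg_cong[OF assms(6), of up_coord] arg_cong[OF assms(6), of ur_coord] by simp_all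
  then show ?thesis using assms(1-5) unfolding hex_pairs_def hex_dirs_def
    by (elim insertE emptyE Pair_inject,
        simp_all only: coord_linear diff_0 diff_0_right minus_zero mult_minus_right mult_1_right mult_zero_right)
      ((rule FalseE, linarith) | (rule disjI1, intro conjI refl; linarith)
        | (rule disjI2, intro conjI refl; linarith))+
qed

lemma hex_sector_unique:
  assumes "(v, w) \<in> hex_pairs" "(v', w') \<in> hex_pairs" and "0 < s" "0 < t" "0 < s'" "0 < t'"
    and "s *\<^sub>R v + t *\<^sub>R w = s' *\<^sub>R v' + t' *\<^sub>R w'"
  shows "v = v' \<and> w = w'"
proof -
  have "s * up_coord v + t * up_coord w = s' * up_coord v' + t' * up_coord w'"
    "s * ur_coord v + t * ur_coord w = s' * ur_coord v' + t' * ur_coord w'"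
    using arg_cong[OF assms(7), of up_coord] arg_cong[OF assms(7), of ur_coord] by simp_all
  then show ?thesis using assms(1-6) unfolding hex_pairs_def
    by (elim insertE emptyE Pair_inject)
      (simp_all only: coord_linear diff_0 diff_0_right minus_zero mult_minus_right mult_1_right mult_zero_right)
qed

text \<open>Interior points of a sector determine pair and coordinates, but a point on a hexagon ray
  belongs to two sectors. The ray can be the first direction of both pairs, as for
  \<open>up\<close>, the second of both, as for \<open>- up\<close>, or the second of one and the
  first of the other, as for \<open>ur\<close>. This list makes \<open>bent_dist\<close> and
  \<open>on_bent\<close> independent of the chosen pair.\<close>

lemma hex_rep_unique:
  assumes "(v, w) \<in> hex_pairs" "(v', w') \<in> hex_pairs"
    and "0 \<le> s" "0 \<le> t" "0 \<le> s'" "0 \<le> t'"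
    and "s *\<^sub>R v + t *\<^sub>R w = s' *\<^sub>R v' + t' *\<^sub>R w'"
  shows "v = v' \<and> w = w' \<and> s = s' \<and> t = t' \<or>
    s = 0 \<and> s' = 0 \<and> t = t' \<and> (t = 0 \<or> w = w') \<or>
    t = 0 \<and> t' = 0 \<and> s = s' \<and> (s = 0 \<or> v = v') \<or>
    s = 0 \<and> t' = 0 \<and> t = s' \<and> (t = 0 \<or> w = v') \<or>
    t = 0 \<and> s' = 0 \<and> s = t' \<and> (s = 0 \<or> v = w')"
proof -
  have v: "v \<in> hex_dirs" "w \<in> hex_dirs" using hex_dirs_pair[OF assms(1)] by auto
  have v': "v' \<in> hex_dirs" "w' \<in> hex_dirs" using hex_dirs_pair[OF assms(2)] by auto
  consider "0 < s" "0 < t" "0 < s'" "0 < t'" | "s = 0" "0 < t" | "t = 0" "0 < s"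
    | "s = 0" "t = 0" | "s' = 0" "0 < t'" | "t' = 0" "0 < s'" | "s' = 0" "t' = 0"
    using assms(3-6) by linarith
  then show ?thesis
  proof cases
    case 1
    then have "v = v' \<and> w = w'" using hex_sector_unique[OF assms(1,2) _ _ _ _ assms(7)] by simp
    then show ?thesis using hex_pairs_independent[OF assms(1)] assms(7) by blast
  next
    case 2 then show ?thesis using hex_ray_unique[OF v(2) assms(2) _ assms(5,6), of t] assms(7) by auto
  next
    case 3 then show ?thesis using hex_ray_unique[OF v(1) assms(2) _ assms(5,6), of s] assms(7) by auto
  next
    case 4 
    then have "s' = 0 \<and> t' = 0" using hex_pairs_independent[OF assms(2), of 0 0 s' t'] assms(7) by auto
    then show ?thesis using 4 by auto
  next
    case 5 then show ?thesis using hex_ray_unique[OF v'(2) assms(1) _ assms(3,4), of t'] assms(7) by auto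
  next
    case 6 then show ?thesis using hex_ray_unique[OF v'(1) assms(1) _ assms(3,4), of s'] assms(7) by auto
  next
    case 7
    then have "s = 0 \<and> t = 0" using hex_pairs_independent[OF assms(1), of s t 0 0] assms(7) by auto
    then show ?thesis using 7 by auto
  qed
qed

lemma norm_hex_dirs:
  assumes "e \<in> hex_dirs" shows "norm e = 1"
  using assms unfolding hex_dirs_def
  by (auto simp: hour_dir_even norm_Pair power2_eq_square)

lemma F0_hex_pair:
  assumes "(v, w) \<in> hex_pairs" "0 \<le> s" "0 \<le> t"
  shows "F0 (s *\<^sub>R v + t *\<^sub>R w) = s + t"
  using assms unfolding hex_pairs_def by (auto simp: F0_coord)

text \<open>The function \<open>u\<close> of the overview, with the base point as an argument. On
  hexagon rays the pair is ambiguous but the length is not, so the value and not the representation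
  is singled out.\<close>

definition bent_dist :: "(plane \<Rightarrow> real) \<Rightarrow> plane \<Rightarrow> plane \<Rightarrow> real" where
  "bent_dist f p q = (THE d. \<exists>v w s t. (v, w) \<in> hex_pairs \<and> 0 \<le> s \<and> 0 \<le> t \<and>
    q = p + s *\<^sub>R v + t *\<^sub>R w \<and> d = bent_length f p v w s t)"

lemma bent_dist_eq:
  assumes "(v, w) \<in> hex_pairs" "0 \<le> s" "0 \<le> t"
  shows "bent_dist f p (p + s *\<^sub>R v + t *\<^sub>R w) = bent_length f p v w s t"
  unfolding bent_dist_def
proof (rule the_equality)
  show "\<exists>v' w' s' t'. (v', w') \<in> hex_pairs \<and> 0 \<le> s' \<and> 0 \<le> t' \<and>
    p + s *\<^sub>R v + t *\<^sub>R w = p + s' *\<^sub>R v' + t' *\<^sub>R w' \<and>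
    bent_length f p v w s t = bent_length f p v' w' s' t'"
    using assms by blast
next
  fix d
  assume "\<exists>v' w' s' t'. (v', w') \<in> hex_pairs \<and> 0 \<le> s' \<and> 0 \<le> t' \<and>
    p + s *\<^sub>R v + t *\<^sub>R w = p + s' *\<^sub>R v' + t' *\<^sub>R w' \<and> d = bent_length f p v' w' s' t'"
  then obtain v' w' s' t' where r: "(v', w') \<in> hex_pairs" "0 \<le> s'" "0 \<le> t'"
    "s *\<^sub>R v + t *\<^sub>R w = s' *\<^sub>R v' + t' *\<^sub>R w'" "d = bent_length f p v' w' s' t'"
    by (auto simp: add.assoc)
  show "d = bent_length f p v w s t"
    using hex_rep_unique[OF assms(1) r(1) assms(2,3) r(2-4)] r(5)
    by (auto simp: bent_length_def)
qed

text \<open>Says that the path to \<open>x\<close> is an initial part of the path to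
  \<open>q\<close>: the second leg may begin only when the first is complete. Formulating this for
  points instead of curves makes the equality case transitive.\<close>

definition on_bent :: "plane \<Rightarrow> plane \<Rightarrow> plane \<Rightarrow> bool" where
  "on_bent p x q \<longleftrightarrow> (\<exists>v w s t s' t'. (v, w) \<in> hex_pairs \<and> 0 \<le> s' \<and> s' \<le> s \<and> 0 \<le> t' \<and> t' \<le> t \<and>
    (0 < t' \<longrightarrow> s' = s) \<and> q = p + s *\<^sub>R v + t *\<^sub>R w \<and> x = p + s' *\<^sub>R v + t' *\<^sub>R w)"

lemma on_bentI:
  assumes "(v, w) \<in> hex_pairs" "0 \<le> s'" "s' \<le> s" "0 \<le> t'" "t' \<le> t" "0 < t' \<Longrightarrow> s' = s"
  shows "on_bent p (p + s' *\<^sub>R v + t' *\<^sub>R w) (p + s *\<^sub>R v + t *\<^sub>R w)"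
  using assms unfolding on_bent_def by blast

text \<open>Transfers the membership from the pair that witnesses it to a prescribed pair for
  \<open>q\<close>. On a ray that is first direction of one pair and second of the other, the two
  coordinates of \<open>x\<close> change places.\<close>

lemma on_bentE:
  assumes "on_bent p x q" and vw: "(v, w) \<in> hex_pairs" and st: "0 \<le> s" "0 \<le> t"
    and q: "q = p + s *\<^sub>R v + t *\<^sub>R w"
  obtains s' t' where "0 \<le> s'" "s' \<le> s" "0 \<le> t'" "t' \<le> t" "0 < t' \<Longrightarrow> s' = s"
    "x = p + s' *\<^sub>R v + t' *\<^sub>R w"
proof -
  obtain v' w' s2 t2 s3 t3 where 2: "(v', w') \<in> hex_pairs" "0 \<le> s3" "s3 \<le> s2" "0 \<le> t3" "t3 \<le> t2"
    "0 < t3 \<longrightarrow> s3 = s2" "q = p + s2 *\<^sub>R v' + t2 *\<^sub>R w'" "x = p + s3 *\<^sub>R v' + t3 *\<^sub>R w'"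
    using assms(1) unfolding on_bent_def by blast
  have eq: "s *\<^sub>R v + t *\<^sub>R w = s2 *\<^sub>R v' + t2 *\<^sub>R w'"
    using q 2(7) by (simp add: add.assoc)
  have "0 \<le> s2" "0 \<le> t2" using 2 by linarith+
  have "\<exists>s' t'. 0 \<le> s' \<and> s' \<le> s \<and> 0 \<le> t' \<and> t' \<le> t \<and> (0 < t' \<longrightarrow> s' = s) \<and>
      s3 *\<^sub>R v' + t3 *\<^sub>R w' = s' *\<^sub>R v + t' *\<^sub>R w"
    using hex_rep_unique[OF vw 2(1) st \<open>0 \<le> s2\<close> \<open>0 \<le> t2\<close> eq]
  proof (elim disjE)
    assume "s = 0 \<and> t2 = 0 \<and> t = s2 \<and> (t = 0 \<or> w = v')"
    then show ?thesis using 2(2-6) by (intro exI[of _ 0] exI[of _ s3]) auto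
  next
    assume "t = 0 \<and> s2 = 0 \<and> s = t2 \<and> (s = 0 \<or> v = w')"
    then show ?thesis using 2(2-6) by (intro exI[of _ t3] exI[of _ 0]) auto
  qed (use 2(2-6) in \<open>(intro exI[of _ s3] exI[of _ t3], auto)+\<close>)
  then show thesis using that 2(8) by (auto simp: add.assoc)
qed

lemma on_bent_trans:
  assumes "on_bent p x y" "on_bent p y q" shows "on_bent p x q"
proof -
  obtain v w s t s1 t1 where 1: "(v, w) \<in> hex_pairs" "0 \<le> s1" "s1 \<le> s" "0 \<le> t1" "t1 \<le> t"
    "0 < t1 \<longrightarrow> s1 = s" "q = p + s *\<^sub>R v + t *\<^sub>R w" "y = p + s1 *\<^sub>R v + t1 *\<^sub>R w"
    using assms(2) unfolding on_bent_def by blast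
  obtain s' t' where 2: "0 \<le> s'" "s' \<le> s1" "0 \<le> t'" "t' \<le> t1" "0 < t' \<Longrightarrow> s' = s1"
    "x = p + s' *\<^sub>R v + t' *\<^sub>R w"
    using on_bentE[OF assms(1) 1(1,2,4,8)] by metis
  have "0 < t' \<Longrightarrow> s' = s" using 1(6) 2(4,5) by force
  then show ?thesis unfolding 2(6) 1(7) using 1 2 by (intro on_bentI) auto
qed

section \<open>The length of the two-segment path as a distance\<close>

definition hex_cone :: "plane \<Rightarrow> plane \<Rightarrow> plane set" where
  "hex_cone v w = {s *\<^sub>R v + t *\<^sub>R w | s t. 0 \<le> s \<and> 0 \<le> t}"

lemma hex_coneE:
  assumes "z - p \<in> hex_cone v w"
  obtains s t where "0 \<le> s" "0 \<le> t" "z = p + s *\<^sub>R v + t *\<^sub>R w"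
proof -
  obtain s t where st: "0 \<le> s" "0 \<le> t" "z - p = s *\<^sub>R v + t *\<^sub>R w"
    using assms unfolding hex_cone_def by (elim CollectE exE conjE)
  have "z = p + (z - p)" by simp
  then show thesis using that[OF st(1,2)] unfolding st(3) add.assoc by blast
qed

lemma closed_hex_cone:
  assumes "(v, w) \<in> hex_pairs"
  shows "closed (hex_cone v w)"
proof -
  obtain \<sigma> \<tau> :: "plane \<Rightarrow> real" where st: "linear \<sigma>" "linear \<tau>"
    "\<And>z. z = \<sigma> z *\<^sub>R v + \<tau> z *\<^sub>R w" "\<And>s t. \<sigma> (s *\<^sub>R v + t *\<^sub>R w) = s"
    "\<And>s t. \<tau> (s *\<^sub>R v + t *\<^sub>R w) = t"
    using hex_pairs_coords[OF assms] by metis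
  have "hex_cone v w = {z. 0 \<le> \<sigma> z} \<inter> {z. 0 \<le> \<tau> z}"
    unfolding hex_cone_def using st by (auto; metis)
  moreover have "continuous_on UNIV \<sigma>" "continuous_on UNIV \<tau>"
    using st(1,2) by (simp_all add: linear_continuous_on linear_conv_bounded_linear)
  ultimately show ?thesis
    by (auto intro!: closed_Int closed_Collect_le)
qed

lemma on_bent_refl: "on_bent p x x"
proof -
  obtain v w s t where "(v, w) \<in> hex_pairs" "0 \<le> s" "0 \<le> t" "x - p = s *\<^sub>R v + t *\<^sub>R w"
    by (rule hex_pairs_cover)
  then show ?thesis using on_bentI[of v w s s t t p] by (simp add: algebra_simps)
qed

lemma bent_dist_self [simp]: "bent_dist f p p = 0"
  using bent_dist_eq[of up ur 0 0 f p] by (simp add: hex_pairs_def bent_length_def)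

locale hex_plane = hex_factor f up ur c for f c
begin

lemma hex_pairs_good:
  assumes "(v, w) \<in> hex_pairs"
  shows "good_pair f v w"
proof -
  interpret m: hex_factor f up "up - ur" c by (rule mirror)
  show ?thesis
    using assms good_pair_1 good_pair_3 good_pair_5 m.good_pair_1 m.good_pair_3 m.good_pair_5
    unfolding hex_pairs_def by auto
qed

text \<open>Within one closed sector, equality is possible only for a step along \<open>w\<close>,
  or along \<open>v\<close> while \<open>t = 0\<close>. These are the steps that prolong the path;
  all others are strict.\<close>

lemma bent_dist_step_sector:
  assumes vw: "(v, w) \<in> hex_pairs" and nn: "0 \<le> s" "0 \<le> t" "0 \<le> s'" "0 \<le> t'"
    and e: "e \<in> hex_dirs" and h: "0 < h"
    and x: "x = p + s *\<^sub>R v + t *\<^sub>R w" and y: "y = p + s' *\<^sub>R v + t' *\<^sub>R w"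
    and xy: "y = x + h *\<^sub>R e"
  shows "bent_dist f p y \<le> bent_dist f p x + seg_length f x e h"
    and "bent_dist f p y = bent_dist f p x + seg_length f x e h \<Longrightarrow> on_bent p x y"
proof -
  have gp: "good_pair f v w" by (rule hex_pairs_good[OF vw])
  have d: "bent_dist f p x = bent_length f p v w s t" "bent_dist f p y = bent_length f p v w s' t'"
    unfolding x y by (simp_all add: bent_dist_eq vw nn)
  have eq: "s' *\<^sub>R v + t' *\<^sub>R w = s *\<^sub>R v + t *\<^sub>R w + h *\<^sub>R e"
    using xy unfolding x y by (simp add: add.assoc)
  note ind = hex_pairs_independent[OF vw]
  note other = bent_length_other[OF gp cont gt_1 nn(1,2) h, of p, folded x]
  from e consider "e = v" | "e = w" | "e = w - v" | "e = - v" | "e = - w" | "e = v - w"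
    unfolding hex_dirs_pair(1)[OF vw] by auto
  then have "bent_dist f p y < bent_dist f p x + seg_length f x e h \<or>
      bent_dist f p y = bent_dist f p x + seg_length f x e h \<and> on_bent p x y"
  proof cases
    case 1
    have st: "s' = s + h" "t' = t" using ind[of s' t' "s + h" t] eq unfolding 1 by (simp_all add: algebra_simps)
    show ?thesis
    proof (cases "t = 0")
      case True
      have "on_bent p x y" unfolding x y using on_bentI[OF vw, of s s' t t'] nn h st True by simp
      then show ?thesis using bent_length_first(1)[OF gp cont nn(1,2) h, of p, folded x] 1 st d by auto
    next
      case False
      then show ?thesis using bent_length_first(2)[OF gp cont nn(1,2) h, of p, folded x] 1 st d nn by auto
    qed
  next
    case 2
    have st: "s' = s" "t' = t + h" using ind[of s' t' s "t + h"] eq unfolding 2 by (simp_all add: algebra_simps)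
    have "on_bent p x y" unfolding x y using on_bentI[OF vw, of s s' t t'] nn h st by simp
    then show ?thesis using bent_length_second[OF cont nn(2), of h p v w s, folded x] 2 st d h by auto
  next
    case 3
    have "s' = s - h" "t' = t + h"
      using ind[of s' t' "s - h" "t + h"] eq unfolding 3 by (simp_all add: algebra_simps)
    then show ?thesis using other(1) 3 d nn by simp
  next
    case 4
    have "s' = s - h" "t' = t"
      using ind[of s' t' "s - h" t] eq unfolding 4 by (simp_all add: algebra_simps)
    then show ?thesis using other(2) 4 d nn by simp
  next
    case 5
    have "s' = s" "t' = t - h"
      using ind[of s' t' s "t - h"] eq unfolding 5 by (simp_all add: algebra_simps)
    then show ?thesis using other(3) 5 d nn by simp
  next
    case 6
    have "s' = s + h" "t' = t - h"
      using ind[of s' t' "s + h" "t - h"] eq unfolding 6 by (simp_all add: algebra_simps)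
    then show ?thesis using other(4) 6 d nn by simp
  qed
  then show "bent_dist f p y \<le> bent_dist f p x + seg_length f x e h"
    "bent_dist f p y = bent_dist f p x + seg_length f x e h \<Longrightarrow> on_bent p x y" by auto
qed

text \<open>The segment may cross several sectors. The claim \<open>P\<close>, including its
  equality case, is additive over adjacent intervals, so by bisection it suffices to prove it on
  small intervals around each parameter.\<close>

lemma bent_dist_step:
  assumes e: "e \<in> hex_dirs" and "0 \<le> h"
  shows "bent_dist f p (x + h *\<^sub>R e) \<le> bent_dist f p x + seg_length f x e h \<and>
    (bent_dist f p (x + h *\<^sub>R e) = bent_dist f p x + seg_length f x e h \<longrightarrow>
      on_bent p x (x + h *\<^sub>R e))"
proof -
  define g where "g r = x + r *\<^sub>R e" for r
  define P where "P r r' \<longleftrightarrow> (r \<le> r' \<longrightarrow>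
    bent_dist f p (g r') \<le> bent_dist f p (g r) + seg_length f (g r) e (r' - r) \<and>
    (bent_dist f p (g r') = bent_dist f p (g r) + seg_length f (g r) e (r' - r) \<longrightarrow>
      on_bent p (g r) (g r')))" for r r'
  have trans: "P r t" if "P r s" "P s t" "r \<le> s" "s \<le> t" for r s t
  proof -
    have sum: "seg_length f (g r) e (t - r) = seg_length f (g r) e (s - r) + seg_length f (g s) e (t - s)"
      using seg_length_add[OF cont, of "s - r" "t - s" "g r" e] that
      by (simp add: g_def algebra_simps)
    have 1: "bent_dist f p (g s) \<le> bent_dist f p (g r) + seg_length f (g r) e (s - r)"
      "bent_dist f p (g s) = bent_dist f p (g r) + seg_length f (g r) e (s - r) \<Longrightarrow> on_bent p (g r) (g s)"
      using that(1,3) unfolding P_def by blast+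
    have 2: "bent_dist f p (g t) \<le> bent_dist f p (g s) + seg_length f (g s) e (t - s)"
      "bent_dist f p (g t) = bent_dist f p (g s) + seg_length f (g s) e (t - s) \<Longrightarrow> on_bent p (g s) (g t)"
      using that(2,4) unfolding P_def by blast+
    show ?thesis unfolding P_def
    proof (intro impI conjI)
      show "bent_dist f p (g t) \<le> bent_dist f p (g r) + seg_length f (g r) e (t - r)"
        using 1(1) 2(1) sum by linarith
      assume "bent_dist f p (g t) = bent_dist f p (g r) + seg_length f (g r) e (t - r)"
      then have "on_bent p (g r) (g s)" "on_bent p (g s) (g t)"
        using 1(1) 2(1) sum by (auto intro!: 1(2) 2(2))
      then show "on_bent p (g r) (g t)" by (rule on_bent_trans)
    qed
  qed
  have same: "P r r'" if vw: "(v, w) \<in> hex_pairs" and in_cone: "g r - p \<in> hex_cone v w" "g r' - p \<in> hex_cone v w"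
    for v w r r'
  proof -
    obtain s t where st: "0 \<le> s" "0 \<le> t" and g: "g r = p + s *\<^sub>R v + t *\<^sub>R w"
      by (rule hex_coneE[OF in_cone(1)])
    obtain s' t' where st': "0 \<le> s'" "0 \<le> t'" and g': "g r' = p + s' *\<^sub>R v + t' *\<^sub>R w"
      by (rule hex_coneE[OF in_cone(2)])
    show ?thesis
    proof (cases "r < r'")
      case True
      have "0 < r' - r" "g r' = g r + (r' - r) *\<^sub>R e"
        using True by (simp_all add: g_def algebra_simps)
      note step = bent_dist_step_sector[OF vw st(1,2) st'(1,2) e this(1) g g' this(2)]
      show ?thesis unfolding P_def using step by blast
    next
      case False
      then show ?thesis unfolding P_def by (auto simp: on_bent_refl)
    qed
  qed
  have "P 0 h"
  proof (induction rule: Bolzano[OF \<open>0 \<le> h\<close>])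
    case (1 a b c) then show ?case using trans by blast
  next
    case (2 r0)
    \<comment> \<open>The union of the closed sectors that miss the point at \<open>r0\<close>. It
      is closed as a finite union, so a point near the one at \<open>r0\<close> avoids
      \<open>B\<close>, and any sector containing it also contains the point at
      \<open>r0\<close>.\<close>
    define B where "B = (\<Union>(v, w)\<in>{(v, w) \<in> hex_pairs. g r0 - p \<notin> hex_cone v w}. hex_cone v w)"
    have "finite hex_pairs" unfolding hex_pairs_def by simp
    then have "closed B" unfolding B_def
      by (intro closed_UN) (auto intro: closed_hex_cone rev_finite_subset)
    moreover have "continuous_on UNIV (\<lambda>r. g r - p)"
      unfolding g_def by (intro continuous_intros)
    ultimately have "open ((\<lambda>r. g r - p) -` (- B))"
      by (intro open_vimage) auto
    moreover have "r0 \<in> (\<lambda>r. g r - p) -` (- B)" unfolding B_def by auto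
    ultimately obtain d where d: "0 < d" "\<And>r. dist r r0 < d \<Longrightarrow> g r - p \<notin> B"
      unfolding open_dist by auto
    have near: "\<exists>v w. (v, w) \<in> hex_pairs \<and> g r - p \<in> hex_cone v w \<and> g r0 - p \<in> hex_cone v w"
      if "dist r r0 < d" for r
    proof -
      obtain v w s t where "(v, w) \<in> hex_pairs" "0 \<le> s" "0 \<le> t" "g r - p = s *\<^sub>R v + t *\<^sub>R w"
        by (rule hex_pairs_cover)
      then have "(v, w) \<in> hex_pairs" "g r - p \<in> hex_cone v w" unfolding hex_cone_def by blast+
      then show ?thesis using d(2)[OF that] unfolding B_def by blast
    qed
    show ?case
    proof (intro exI[of _ d] conjI allI impI d(1))
      \<comment> \<open>The points at \<open>r\<close> and \<open>r'\<close> may lie in different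
        sectors, but each shares one with the point at \<open>r0\<close>, where the interval is
        split.\<close>
      fix r r' assume r: "r \<le> r0 \<and> r0 \<le> r' \<and> r' - r < d"
      then have "dist r r0 < d" "dist r' r0 < d" by (auto simp: dist_real_def)
      then obtain v w v' w' where
        "(v, w) \<in> hex_pairs" "g r - p \<in> hex_cone v w" "g r0 - p \<in> hex_cone v w"
        "(v', w') \<in> hex_pairs" "g r' - p \<in> hex_cone v' w'" "g r0 - p \<in> hex_cone v' w'"
        using near[of r] near[of r'] by blast
      then have "P r r0" "P r0 r'" by (blast intro: same)+
      then show "P r r'" using trans r by blast
    qed
  qed
  then show ?thesis using \<open>0 \<le> h\<close> by (simp add: P_def g_def)
qed

text \<open>The path from \<open>x\<close> to \<open>q\<close> consists of two segments in hexagon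
  directions, and \<open>bent_dist_step\<close> with base point \<open>p\<close> bounds the growth
  along each. Equality in the sum forces equality in both steps.\<close>

lemma bent_dist_triangle:
  shows "bent_dist f p q \<le> bent_dist f p x + bent_dist f x q"
    and "bent_dist f p q = bent_dist f p x + bent_dist f x q \<Longrightarrow> on_bent p x q"
proof -
  obtain v w s t where vw: "(v, w) \<in> hex_pairs" and st: "0 \<le> s" "0 \<le> t" and "q - x = s *\<^sub>R v + t *\<^sub>R w"
    by (rule hex_pairs_cover)
  then have q: "q = x + s *\<^sub>R v + t *\<^sub>R w" by (simp add: algebra_simps)
  have d: "bent_dist f x q = seg_length f x v s + seg_length f (x + s *\<^sub>R v) w t"
    unfolding q bent_dist_eq[OF vw st] bent_length_def ..
  note hex_dirs_pair(2,3)[OF vw]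
  note 1 = bent_dist_step[OF this(1) st(1), of p x] bent_dist_step[OF this(2) st(2), of p "x + s *\<^sub>R v"]
  show "bent_dist f p q \<le> bent_dist f p x + bent_dist f x q"
    using 1 d q by auto
  show "on_bent p x q" if "bent_dist f p q = bent_dist f p x + bent_dist f x q"
  proof -
    have "on_bent p x (x + s *\<^sub>R v)" "on_bent p (x + s *\<^sub>R v) q"
      using 1 d q that by auto
    then show ?thesis by (rule on_bent_trans)
  qed
qed

text \<open>The legs from \<open>x\<close> to \<open>y\<close> have total length
  \<open>F0 (y - x)\<close> and their directions are Euclidean unit vectors, so they stay in the
  ball where \<open>M\<close> bounds \<open>f\<close>.\<close>

lemma bent_dist_local:
  assumes "\<And>z. norm (z - x) \<le> F0 (y - x) \<Longrightarrow> f z \<le> M"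
  shows "bent_dist f p y \<le> bent_dist f p x + M * F0 (y - x)"
proof -
  obtain v w s t where vw: "(v, w) \<in> hex_pairs" and st: "0 \<le> s" "0 \<le> t" and xy: "y - x = s *\<^sub>R v + t *\<^sub>R w"
    by (rule hex_pairs_cover)
  then have y: "y = x + s *\<^sub>R v + t *\<^sub>R w" by (simp add: algebra_simps)
  have F: "F0 (y - x) = s + t" unfolding xy by (rule F0_hex_pair[OF vw st])
  have n: "norm v = 1" "norm w = 1" using norm_hex_dirs hex_dirs_pair[OF vw] by auto
  have 1: "seg_length f x v s \<le> M * s"
    by (rule seg_length_le[OF cont st(1)]) (use assms F n st in auto)
  have 2: "seg_length f (x + s *\<^sub>R v) w t \<le> M * t"
  proof (rule seg_length_le[OF cont st(2)])
    fix r :: real assume r: "0 \<le> r" "r \<le> t"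
    have "norm (s *\<^sub>R v + r *\<^sub>R w) \<le> s + r"
      using norm_triangle_ineq[of "s *\<^sub>R v" "r *\<^sub>R w"] n st r by simp
    then show "f (x + s *\<^sub>R v + r *\<^sub>R w) \<le> M"
      using r by (intro assms) (simp add: F add.assoc)
  qed
  have "bent_dist f x y = seg_length f x v s + seg_length f (x + s *\<^sub>R v) w t"
    unfolding y bent_dist_eq[OF vw st] bent_length_def ..
  then show ?thesis using bent_dist_triangle(1)[of p y x] 1 2 F by (simp add: distrib_left)
qed

end

section \<open>Lower bound for the length of piecewise smooth paths\<close>

lemma partition_mono:
  fixes \<tau> :: "nat \<Rightarrow> real"
  assumes "\<forall>i<n. \<tau> i < \<tau> (Suc i)" "m \<le> n"
  shows "\<tau> 0 \<le> \<tau> m"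
  using assms(2)
proof (induction m)
  case (Suc m)
  then have "\<tau> 0 \<le> \<tau> m" "\<tau> m < \<tau> (Suc m)" using assms(1) by auto
  then show ?case by linarith
qed simp

lemma partition_cases:
  fixes \<tau> :: "nat \<Rightarrow> real"
  assumes "\<tau> 0 \<le> t" "t \<le> \<tau> m"
  shows "t \<in> \<tau> ` {..m} \<or> (\<exists>i<m. t \<in> {\<tau> i<..<\<tau> (Suc i)})"
  using assms
proof (induction m)
  case (Suc m)
  show ?case
  proof (cases "t \<le> \<tau> m")
    case True
    then show ?thesis using Suc by (auto simp: less_Suc_eq atMost_Suc)
  next
    case False
    then show ?thesis using Suc.prems by (cases "t = \<tau> (Suc m)") auto
  qed
qed auto

lemma smooth_on_intervalE:
  assumes "smooth_on_interval \<gamma> u v"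
  obtains \<delta> where "continuous_on {u..v} \<delta>"
    "\<And>t. t \<in> {u..v} \<Longrightarrow> (\<gamma> has_vector_derivative \<delta> t) (at t within {u..v})"
proof -
  obtain D where D: "\<forall>t\<in>{u..v}. D 0 t = \<gamma> t"
    "\<forall>n. \<forall>t\<in>{u..v}. (D n has_vector_derivative D (Suc n) t) (at t within {u..v})"
    using assms unfolding smooth_on_interval_def by blast
  have "continuous_on {u..v} (D 1)"
    using D(2) by (auto simp: continuous_on_eq_continuous_within intro: has_vector_derivative_continuous)
  moreover have "(\<gamma> has_vector_derivative D 1 t) (at t within {u..v})" if "t \<in> {u..v}" for t
    by (rule has_vector_derivative_transform[OF that, of _ "D 0"]) (use D that in auto)
  ultimately show thesis by (rule that)
qed

section \<open>Regularity of a piecewise smooth path\<close>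

context
  fixes \<gamma> :: "real \<Rightarrow> plane" and t0 s0 :: real
  assumes pw: "piecewise_smooth \<gamma> t0 s0"
begin

abbreviation (input) "velocity \<equiv> \<lambda>t. vector_derivative \<gamma> (at t within {t0..s0})"

text \<open>The integrand \<open>G\<close> is left general so that a single induction over the
  pieces serves both \<open>F0\<close> and \<open>conformal_finsler f\<close>. At break points the
  velocity may differ from the one-sided derivatives, which integrals do not see.\<close>

lemma piecewise_smooth_facts:
  shows "continuous_on {t0..s0} \<gamma>"
    and "\<exists>S. finite S \<and> (\<forall>t\<in>{t0<..<s0} - S. (\<gamma> has_vector_derivative velocity t) (at t))"
    and "continuous_on UNIV (\<lambda>(x, y). G x y) \<Longrightarrow> (\<lambda>t. G (\<gamma> t) (velocity t) :: 'b::banach) integrable_on {t0..s0}"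
proof -
  obtain n \<tau> where \<tau>: "\<tau> 0 = t0" "\<tau> n = s0" "\<forall>i<n. \<tau> i < \<tau> (Suc i)"
    "\<And>i. i < n \<Longrightarrow> smooth_on_interval \<gamma> (\<tau> i) (\<tau> (Suc i))"
    using pw unfolding piecewise_smooth_def by blast
  have ge: "t0 \<le> \<tau> m" if "m \<le> n" for m using partition_mono[OF \<tau>(3) that] \<tau>(1) by simp
  have le: "\<tau> m \<le> s0" if "m \<le> n" for m
  proof -
    have "\<forall>i<n-m. \<tau> (m + i) < \<tau> (m + Suc i)" using \<tau>(3) by auto
    from partition_mono[of "n - m" "\<lambda>i. \<tau> (m + i)", OF this order_refl] that \<tau>(2) show ?thesis by simp
  qed
  have deriv: "(\<gamma> has_vector_derivative y) (at t)" "velocity t = y"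
    if "i < n" "t \<in> {\<tau> i<..<\<tau> (Suc i)}"
      "(\<gamma> has_vector_derivative y) (at t within {\<tau> i..\<tau> (Suc i)})" for i t y
  proof -
    show 1: "(\<gamma> has_vector_derivative y) (at t)"
      using that at_within_Icc_at[of "\<tau> i" t "\<tau> (Suc i)"] by auto
    have "t0 \<le> \<tau> i" "\<tau> (Suc i) \<le> s0" using that ge le by auto
    then have "at t within {t0..s0} = at t" using that at_within_Icc_at[of t0 t s0] by auto
    then show "velocity t = y" using vector_derivative_at[OF 1] by simp
  qed
  show "\<exists>S. finite S \<and> (\<forall>t\<in>{t0<..<s0} - S. (\<gamma> has_vector_derivative velocity t) (at t))"
  proof (intro exI[of _ "\<tau> ` {..n}"] conjI ballI)
    fix t assume "t \<in> {t0<..<s0} - \<tau> ` {..n}"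
    then obtain i where i: "i < n" "t \<in> {\<tau> i<..<\<tau> (Suc i)}"
      using partition_cases[of \<tau> t n] \<tau>(1,2) by auto
    obtain \<delta> where "\<And>t. t \<in> {\<tau> i..\<tau> (Suc i)} \<Longrightarrow> (\<gamma> has_vector_derivative \<delta> t) (at t within {\<tau> i..\<tau> (Suc i)})"
      using smooth_on_intervalE[OF \<tau>(4)[OF i(1)]] by blast
    then have "(\<gamma> has_vector_derivative \<delta> t) (at t within {\<tau> i..\<tau> (Suc i)})" using i by auto
    then show "(\<gamma> has_vector_derivative velocity t) (at t)" using deriv[OF i] by simp
  qed simp
  have "continuous_on {t0..\<tau> m} \<gamma> \<and> (continuous_on UNIV (\<lambda>(x, y). G x y) \<longrightarrow>
      (\<lambda>t. G (\<gamma> t) (velocity t)) integrable_on {t0..\<tau> m})" if "m \<le> n" for m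
    using that
  proof (induction m)
    case 0 then show ?case by (simp add: \<tau>(1) integrable_on_refl[of _ t0, simplified])
  next
    case (Suc m)
    then have m: "m < n" and IH: "continuous_on {t0..\<tau> m} \<gamma>" "continuous_on UNIV (\<lambda>(x, y). G x y) \<Longrightarrow>
      (\<lambda>t. G (\<gamma> t) (velocity t)) integrable_on {t0..\<tau> m}" by auto
    have o: "t0 \<le> \<tau> m" "\<tau> m \<le> \<tau> (Suc m)" using ge[of m] \<tau>(3) m by auto
    obtain \<delta> where \<delta>: "continuous_on {\<tau> m..\<tau> (Suc m)} \<delta>"
      "\<And>t. t \<in> {\<tau> m..\<tau> (Suc m)} \<Longrightarrow> (\<gamma> has_vector_derivative \<delta> t) (at t within {\<tau> m..\<tau> (Suc m)})"
      using smooth_on_intervalE[OF \<tau>(4)[OF m]] by blast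
    have c: "continuous_on {\<tau> m..\<tau> (Suc m)} \<gamma>"
      unfolding continuous_on_eq_continuous_within
      by (blast intro: has_vector_derivative_continuous[OF \<delta>(2)])
    have vel: "velocity t = \<delta> t" if "\<tau> m < t" "t < \<tau> (Suc m)" for t
      by (rule deriv(2)[OF m _ \<delta>(2)]) (use that in auto)
    have "{t0..\<tau> (Suc m)} = {t0..\<tau> m} \<union> {\<tau> m..\<tau> (Suc m)}" using o by auto
    then have "continuous_on {t0..\<tau> (Suc m)} \<gamma>"
      using continuous_on_closed_Un[OF _ _ IH(1) c] by simp
    moreover have "(\<lambda>t. G (\<gamma> t) (velocity t)) integrable_on {t0..\<tau> (Suc m)}"
      if G: "continuous_on UNIV (\<lambda>(x, y). G x y)"
    proof (rule Henstock_Kurzweil_Integration.integrable_combine[OF o IH(2)[OF G]])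
      have "continuous_on {\<tau> m..\<tau> (Suc m)} (\<lambda>t. (\<lambda>(x, y). G x y) (\<gamma> t, \<delta> t))"
        by (rule continuous_on_compose2[OF G]) (auto intro!: continuous_intros c \<delta>)
      then have "(\<lambda>t. G (\<gamma> t) (\<delta> t)) integrable_on {\<tau> m..\<tau> (Suc m)}"
        by (simp add: integrable_continuous_interval)
      then show "(\<lambda>t. G (\<gamma> t) (velocity t)) integrable_on {\<tau> m..\<tau> (Suc m)}"
        by (rule integrable_spike_finite[of "{\<tau> m, \<tau> (Suc m)}", rotated 2])
          (auto simp: vel)
    qed
    ultimately show ?case by blast
  qed
  from this[of n] show "continuous_on {t0..s0} \<gamma>"
    "continuous_on UNIV (\<lambda>(x, y). G x y) \<Longrightarrow> (\<lambda>t. G (\<gamma> t) (velocity t)) integrable_on {t0..s0}"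
    by (simp_all add: \<tau>(2))
qed

lemma continuous_F0: "continuous_on S g \<Longrightarrow> continuous_on S (\<lambda>x. F0 (g x))"
  unfolding F0_eq by (intro continuous_intros) auto

lemma F0_velocity_integrable:
  "t0 \<le> r \<Longrightarrow> r' \<le> s0 \<Longrightarrow> (\<lambda>t. F0 (velocity t)) integrable_on {r..r'}"
  "continuous_on UNIV f \<Longrightarrow> t0 \<le> r \<Longrightarrow> r' \<le> s0 \<Longrightarrow>
    (\<lambda>t. conformal_finsler f (\<gamma> t) (velocity t)) integrable_on {r..r'}"
proof -
  assume r: "t0 \<le> r" "r' \<le> s0"
  have "(\<lambda>t. F0 (velocity t)) integrable_on {t0..s0}"
    using piecewise_smooth_facts(3)[of "\<lambda>x y. F0 y"]
    by (simp add: case_prod_beta continuous_F0 continuous_on_snd)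
  then show "(\<lambda>t. F0 (velocity t)) integrable_on {r..r'}"
    by (rule integrable_on_subinterval) (use r in auto)
next
  assume r: "t0 \<le> r" "r' \<le> s0" and f: "continuous_on UNIV f"
  have "(\<lambda>t. conformal_finsler f (\<gamma> t) (velocity t)) integrable_on {t0..s0}"
    by (rule piecewise_smooth_facts(3)) (auto simp: case_prod_beta conformal_finsler_def
      intro!: continuous_intros continuous_F0 continuous_on_compose2[OF f])
  then show "(\<lambda>t. conformal_finsler f (\<gamma> t) (velocity t)) integrable_on {r..r'}"
    by (rule integrable_on_subinterval) (use r in auto)
qed

text \<open>By \<open>F0_coord\<close>, \<open>F0\<close> is a maximum of absolute values of linear
  forms, and each linear form commutes with the integral of the velocity.\<close>

lemma F0_displacement_le:
  assumes r: "t0 \<le> r" "r \<le> r'" "r' \<le> s0"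
  shows "F0 (\<gamma> r' - \<gamma> r) \<le> integral {r..r'} (\<lambda>t. F0 (velocity t))"
proof -
  obtain S where S: "finite S" "\<And>t. t \<in> {t0<..<s0} - S \<Longrightarrow> (\<gamma> has_vector_derivative velocity t) (at t)"
    using piecewise_smooth_facts(2) by blast
  have hi: "(velocity has_integral (\<gamma> r' - \<gamma> r)) {r..r'}"
    by (rule fundamental_theorem_of_calculus_interior_strong[OF S(1) r(2)])
      (use r S(2) continuous_on_subset[OF piecewise_smooth_facts(1)] in auto)
  have bound: "\<bar>l (\<gamma> r' - \<gamma> r)\<bar> \<le> integral {r..r'} (\<lambda>t. F0 (velocity t))"
    if l: "linear l" "\<And>z. \<bar>l z\<bar> \<le> F0 z" for l :: "plane \<Rightarrow> real"
  proof -
    have "((\<lambda>t. l (velocity t)) has_integral l (\<gamma> r' - \<gamma> r)) {r..r'}"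
      using has_integral_linear[OF hi, of l] l(1) by (simp add: linear_conv_bounded_linear o_def)
    then have "l (\<gamma> r' - \<gamma> r) = integral {r..r'} (\<lambda>t. l (velocity t))"
      "(\<lambda>t. l (velocity t)) integrable_on {r..r'}" by (auto simp: has_integral_iff)
    then show ?thesis
      using integral_norm_bound_integral[of "\<lambda>t. l (velocity t)" "{r..r'}" "\<lambda>t. F0 (velocity t)"]
        F0_velocity_integrable(1)[OF r(1,3)] l(2) by simp
  qed
  show ?thesis unfolding F0_coord[of "\<gamma> r' - \<gamma> r"]
    using bound[of up_coord] bound[of ur_coord] bound[of "\<lambda>z. up_coord z + ur_coord z"]
    by (simp add: linear_iff F0_coord algebra_simps)
qed

end

lemma F0_le_norm: "F0 z \<le> 2 * norm z"
proof -
  have x: "\<bar>fst z\<bar> \<le> norm z" "\<bar>snd z\<bar> \<le> norm z"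
    using norm_fst_le[of "fst z" "snd z"] norm_snd_le[of "snd z" "fst z"] by simp_all
  have "1 \<le> sqrt 3" by simp
  then have "\<bar>fst z\<bar> / sqrt 3 \<le> \<bar>fst z\<bar>" by (simp add: divide_le_eq mult_le_cancel_left1)
  then show ?thesis using x unfolding F0_eq by simp
qed

context hex_plane
begin

text \<open>Proved with \<open>f + \<epsilon>\<close> in place of \<open>f\<close>, after which
  \<epsilon> tends to 0. The slack makes the inequality true on short intervals around each time
  \<open>y\<close>: there \<open>M = f (\<gamma> y) + \<epsilon> / 2\<close> bounds \<open>f\<close>
  from above near the curve and is still at most \<open>f (\<gamma> t) + \<epsilon>\<close> on it.
  Bisection joins the intervals.\<close>

lemma bent_dist_le_length:
  assumes pw: "piecewise_smooth \<gamma> t0 s0" and r: "t0 \<le> r" "r \<le> r'" "r' \<le> s0"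
  shows "bent_dist f p (\<gamma> r') \<le> bent_dist f p (\<gamma> r) +
    integral {r..r'} (\<lambda>t. conformal_finsler f (\<gamma> t) (vector_derivative \<gamma> (at t within {t0..s0})))"
proof -
  define \<phi> where "\<phi> t = F0 (vector_derivative \<gamma> (at t within {t0..s0}))" for t
  have \<phi>: "0 \<le> \<phi> t" for t by (simp add: \<phi>_def F0_norm)
  note int = F0_velocity_integrable[OF pw, folded \<phi>_def, unfolded conformal_finsler_def, folded \<phi>_def]
  note cg = piecewise_smooth_facts(1)[OF pw]
  have eps: "bent_dist f p (\<gamma> r') \<le> bent_dist f p (\<gamma> r) + integral {r..r'} (\<lambda>t. (f (\<gamma> t) + \<epsilon>) * \<phi> t)"
    if "0 < \<epsilon>" for \<epsilon>
  proof -
    define P where "P u u' \<longleftrightarrow> (t0 \<le> u \<longrightarrow> u \<le> u' \<longrightarrow> u' \<le> s0 \<longrightarrow>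
      bent_dist f p (\<gamma> u') \<le> bent_dist f p (\<gamma> u) + integral {u..u'} (\<lambda>t. (f (\<gamma> t) + \<epsilon>) * \<phi> t))" for u u'
    have inte: "(\<lambda>t. (f (\<gamma> t) + \<epsilon>) * \<phi> t) integrable_on {u..u'}" if "t0 \<le> u" "u' \<le> s0" for u u'
      using integrable_add[OF int(2)[OF cont that] integrable_on_mult_right[OF int(1)[OF that], of \<epsilon>]]
      by (simp add: distrib_right)
    have "P r r'"
    proof (induction rule: Bolzano[OF \<open>r \<le> r'\<close>])
      case (1 a b c)
      show ?case unfolding P_def
      proof (intro impI)
        assume "t0 \<le> a" "c \<le> s0"
        then have "integral {a..c} (\<lambda>t. (f (\<gamma> t) + \<epsilon>) * \<phi> t) =
          integral {a..b} (\<lambda>t. (f (\<gamma> t) + \<epsilon>) * \<phi> t) + integral {b..c} (\<lambda>t. (f (\<gamma> t) + \<epsilon>) * \<phi> t)"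
          using Henstock_Kurzweil_Integration.integral_combine[OF 1(3,4) inte] by simp
        then show "bent_dist f p (\<gamma> c) \<le> bent_dist f p (\<gamma> a) + integral {a..c} (\<lambda>t. (f (\<gamma> t) + \<epsilon>) * \<phi> t)"
          using 1 \<open>t0 \<le> a\<close> \<open>c \<le> s0\<close> unfolding P_def by force
      qed
    next
      case (2 y)
      then have y: "t0 \<le> y" "y \<le> s0" using r by auto
      obtain d where d: "0 < d" "\<And>z. dist z (\<gamma> y) < d \<Longrightarrow> dist (f z) (f (\<gamma> y)) < \<epsilon> / 2"
        using cont \<open>0 < \<epsilon>\<close> unfolding continuous_on_iff by (metis UNIV_I half_gt_zero)
      \<comment> \<open>With radius \<open>d / 8\<close> the displacement has norm below
        \<open>d / 4\<close>, hence \<open>F0\<close> below \<open>d / 2\<close> by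
        \<open>F0_le_norm\<close>, and every point in the ball of \<open>bent_dist_local\<close> is
        still within \<open>d\<close> of the curve point at \<open>y\<close>.\<close>
      obtain d' where d': "0 < d'" "\<And>t. t \<in> {t0..s0} \<Longrightarrow> dist t y < d' \<Longrightarrow> dist (\<gamma> t) (\<gamma> y) < d / 8"
        using cg y d(1) unfolding continuous_on_iff
        by (metis atLeastAtMost_iff divide_pos_pos zero_less_numeral)
      show ?case
      proof (intro exI[of _ d'] conjI d'(1) allI impI)
        fix u u' assume u: "u \<le> y \<and> y \<le> u' \<and> u' - u < d'"
        show "P u u'" unfolding P_def
        proof (intro impI)
          assume u0: "t0 \<le> u" "u \<le> u'" "u' \<le> s0"
          have near: "dist (\<gamma> t) (\<gamma> y) < d / 8" if "t \<in> {u..u'}" for t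
            using d'(2)[of t] u u0 that by (auto simp: dist_real_def)
          have nu: "norm (\<gamma> u' - \<gamma> u) < d / 4"
            using near[of u] near[of u'] u0 dist_triangle_half_l[of "\<gamma> u'" "\<gamma> y" "d / 4" "\<gamma> u"]
            by (simp add: dist_norm)
          define M where "M = f (\<gamma> y) + \<epsilon> / 2"
          have "bent_dist f p (\<gamma> u') \<le> bent_dist f p (\<gamma> u) + M * F0 (\<gamma> u' - \<gamma> u)"
          proof (rule bent_dist_local)
            fix z assume "norm (z - \<gamma> u) \<le> F0 (\<gamma> u' - \<gamma> u)"
            then have "dist z (\<gamma> u) < d / 2" using F0_le_norm[of "\<gamma> u' - \<gamma> u"] nu by (simp add: dist_norm)
            then have "dist z (\<gamma> y) < d"
              using dist_triangle[of z "\<gamma> y" "\<gamma> u"] near[of u] u0 d(1) by simp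
            then show "f z \<le> M" using d(2)[of z] unfolding M_def dist_real_def by linarith
          qed
          also have "M * F0 (\<gamma> u' - \<gamma> u) \<le> M * integral {u..u'} \<phi>"
            using F0_displacement_le[OF pw u0] gt_1[of "\<gamma> y"] \<open>0 < \<epsilon>\<close>
            unfolding \<phi>_def M_def by (intro mult_left_mono) auto
          also have "\<dots> = integral {u..u'} (\<lambda>t. M * \<phi> t)" by simp
          also have "\<dots> \<le> integral {u..u'} (\<lambda>t. (f (\<gamma> t) + \<epsilon>) * \<phi> t)"
          proof (rule integral_le)
            show "(\<lambda>t. M * \<phi> t) integrable_on {u..u'}"
              by (rule integrable_on_mult_right[OF int(1)[OF u0(1,3)]])
            fix t assume "t \<in> {u..u'}"
            then have "dist (\<gamma> t) (\<gamma> y) < d" using near[of t] d(1) by linarith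
            then have "M \<le> f (\<gamma> t) + \<epsilon>" using d(2)[of "\<gamma> t"] unfolding M_def dist_real_def by linarith
            then show "M * \<phi> t \<le> (f (\<gamma> t) + \<epsilon>) * \<phi> t" by (rule mult_right_mono[OF _ \<phi>])
          qed (rule inte[OF u0(1,3)])
          finally show "bent_dist f p (\<gamma> u') \<le> bent_dist f p (\<gamma> u) +
            integral {u..u'} (\<lambda>t. (f (\<gamma> t) + \<epsilon>) * \<phi> t)" by simp
        qed
      qed
    qed
    then show ?thesis using r by (simp add: P_def)
  qed
  define I where "I = integral {r..r'} \<phi>"
  have I: "0 \<le> I" unfolding I_def by (rule integral_nonneg[OF int(1)]) (use \<phi> r in auto)
  have "integral {r..r'} (\<lambda>t. (f (\<gamma> t) + \<epsilon>) * \<phi> t) = integral {r..r'} (\<lambda>t. f (\<gamma> t) * \<phi> t) + \<epsilon> * I" for \<epsilon>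
    using integral_add[OF int(2)[OF cont r(1,3)] integrable_on_mult_right[OF int(1)[OF r(1,3)], of \<epsilon>]]
    by (simp add: distrib_right I_def)
  then have *: "bent_dist f p (\<gamma> r') \<le> bent_dist f p (\<gamma> r) + integral {r..r'} (\<lambda>t. f (\<gamma> t) * \<phi> t) + \<epsilon> * I"
    if "0 < \<epsilon>" for \<epsilon> using eps[OF that] by simp
  have "bent_dist f p (\<gamma> r') \<le> bent_dist f p (\<gamma> r) + integral {r..r'} (\<lambda>t. f (\<gamma> t) * \<phi> t)"
  proof (rule field_le_epsilon)
    fix e :: real assume "0 < e"
    \<comment> \<open>The denominator is \<open>I + 1\<close> because \<open>I\<close> vanishes for
      a path at rest.\<close>
    then have "e / (I + 1) * I \<le> e" "0 < e / (I + 1)" using I by (auto simp: field_simps)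
    then show "bent_dist f p (\<gamma> r') \<le> bent_dist f p (\<gamma> r) + integral {r..r'} (\<lambda>t. f (\<gamma> t) * \<phi> t) + e"
      using *[of "e / (I + 1)"] by linarith
  qed
  then show ?thesis by (simp add: conformal_finsler_def \<phi>_def)
qed

end

section \<open>Lengths of reparametrizations\<close>

lemma seg_length_antiderivative:
  assumes f: "continuous_on UNIV f"
  shows "\<exists>K. (\<forall>h\<ge>0. (K has_real_derivative f (z + h *\<^sub>R v)) (at h)) \<and>
    (\<forall>h\<ge>0. seg_length f z v h = K h - K 0)"
proof -
  define g where "g t = f (z + t *\<^sub>R v)" for t
  \<comment> \<open>Integration starts at -1 so that the derivative at \<open>h = 0\<close> is
    two-sided; \<open>seg_length\<close> itself is constantly 0 for negative
    \<open>h\<close>.\<close>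
  define K where "K h = integral {- 1..h} g" for h
  have g: "continuous_on S g" for S unfolding g_def by (rule continuous_on_along_line[OF f])
  show ?thesis
  proof (intro exI[of _ K] conjI allI impI)
    fix h :: real assume h: "0 \<le> h"
    have "(K has_vector_derivative g h) (at h within {- 1..h + 1})"
      unfolding K_def by (rule integral_has_vector_derivative[OF g]) (use h in auto)
    then show "(K has_real_derivative f (z + h *\<^sub>R v)) (at h)"
      using h by (simp add: at_within_Icc_at has_real_derivative_iff_has_vector_derivative g_def)
  next
    fix h :: real assume h: "0 \<le> h"
    have "integral {- 1..0} g + integral {0..h} g = integral {- 1..h} g"
      by (rule Henstock_Kurzweil_Integration.integral_combine)
        (use h integrable_continuous_interval[OF g] in auto)
    then show "seg_length f z v h = K h - K 0" 
      unfolding K_def seg_length_def g_def by simp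
  qed
qed

text \<open>Applied to the coordinate at rest: before the corner the second one is at its minimum,
  after it the first one is at its maximum.\<close>

lemma mono_on_extremum_deriv:
  fixes A :: "real \<Rightarrow> real"
  assumes "(A has_real_derivative D) (at x)" "x \<in> {t0<..<s0}"
    and "(\<forall>y\<in>{t0..s0}. A y \<le> A x) \<or> (\<forall>y\<in>{t0..s0}. A x \<le> A y)"
  shows "D = 0"
proof -
  define d where "d = min (x - t0) (s0 - x)"
  have d: "0 < d" "\<And>y. \<bar>x - y\<bar> < d \<Longrightarrow> y \<in> {t0..s0}" using assms(2) by (auto simp: d_def)
  from assms(3) show ?thesis
  proof
    assume "\<forall>y\<in>{t0..s0}. A y \<le> A x"
    then show ?thesis using DERIV_local_max[OF assms(1) d(1)] d(2) by blast
  next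
    assume "\<forall>y\<in>{t0..s0}. A x \<le> A y"
    then show ?thesis using DERIV_local_min[OF assms(1) d(1)] d(2) by blast
  qed
qed

text \<open>The coordinates are affine functions of the curve point, hence differentiable wherever
  \<gamma> is. The length integrand is the derivative of \<Phi>, a sum of antiderivatives along the
  two legs evaluated at \<open>A\<close> and \<open>B\<close>, so the length depends only on the end
  values.\<close>

lemma length_of_bent_path:
  assumes f: "continuous_on UNIV f" and pw: "piecewise_smooth \<gamma> t0 s0"
    and vw: "(v, w) \<in> hex_pairs"
    and form: "\<And>t. t \<in> {t0..s0} \<Longrightarrow> \<gamma> t = p + A t *\<^sub>R v + B t *\<^sub>R w"
    and A: "mono_on {t0..s0} A" "A t0 = 0" "A s0 = s"
    and B: "mono_on {t0..s0} B" "B t0 = 0" "B s0 = t"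
    and AB: "\<And>t. t \<in> {t0..s0} \<Longrightarrow> 0 < B t \<Longrightarrow> A t = s"
  shows "finsler_length (conformal_finsler f) \<gamma> t0 s0 = bent_length f p v w s t"
proof -
  have t0s0: "t0 < s0" using pw by (simp add: piecewise_smooth_def)
  obtain \<sigma> \<tau> :: "plane \<Rightarrow> real" where st: "linear \<sigma>" "linear \<tau>"
    "\<And>z. z = \<sigma> z *\<^sub>R v + \<tau> z *\<^sub>R w" "\<And>s t. \<sigma> (s *\<^sub>R v + t *\<^sub>R w) = s"
    "\<And>s t. \<tau> (s *\<^sub>R v + t *\<^sub>R w) = t"
    using hex_pairs_coords[OF vw] by metis
  have bl: "bounded_linear \<sigma>" "bounded_linear \<tau>" using st(1,2) by (simp_all add: linear_conv_bounded_linear)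
  have AB_eq: "A r = \<sigma> (\<gamma> r - p)" "B r = \<tau> (\<gamma> r - p)" if "r \<in> {t0..s0}" for r
    using form[OF that] st(4,5) by (simp_all add: add.assoc)
  have nn: "0 \<le> A r" "A r \<le> s" "0 \<le> B r" "B r \<le> t" if "r \<in> {t0..s0}" for r
  proof -
    have "t0 \<in> {t0..s0}" "s0 \<in> {t0..s0}" "t0 \<le> r" "r \<le> s0" using that by auto
    note m = mono_onD[OF A(1) this(1) that this(3)] mono_onD[OF A(1) that this(2,4)]
      mono_onD[OF B(1) this(1) that this(3)] mono_onD[OF B(1) that this(2,4)]
    show "0 \<le> A r" "A r \<le> s" "0 \<le> B r" "B r \<le> t"
      using m A(2,3) B(2,3) by simp_all
  qed
  obtain K where "\<forall>h\<ge>0. (K has_real_derivative f (p + h *\<^sub>R v)) (at h)"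
    "\<forall>h\<ge>0. seg_length f p v h = K h - K 0"
    using seg_length_antiderivative[OF f, of p v] by (elim exE conjE)
  note K = this[rule_format]
  obtain K' where "\<forall>h\<ge>0. (K' has_real_derivative f (p + s *\<^sub>R v + h *\<^sub>R w)) (at h)"
    "\<forall>h\<ge>0. seg_length f (p + s *\<^sub>R v) w h = K' h - K' 0"
    using seg_length_antiderivative[OF f, of "p + s *\<^sub>R v" w] by (elim exE conjE)
  note K' = this[rule_format]
  obtain S where S: "finite S" "\<And>r. r \<in> {t0<..<s0} - S \<Longrightarrow>
      (\<gamma> has_vector_derivative vector_derivative \<gamma> (at r within {t0..s0})) (at r)"
    using piecewise_smooth_facts(2)[OF pw] by blast
  define \<Phi> where "\<Phi> r = K (A r) + K' (B r)" for r
  have l: "continuous_on {t0..s0} (\<lambda>r. l (\<gamma> r - p))" if "bounded_linear l" for l :: "plane \<Rightarrow> real"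
    by (rule continuous_on_compose2[OF linear_continuous_on[OF that]])
      (auto intro!: continuous_intros piecewise_smooth_facts(1)[OF pw])
  have "continuous_on {t0..s0} A" "continuous_on {t0..s0} B"
    by (rule continuous_on_eq[OF l[OF bl(1)]], simp add: AB_eq)
      (rule continuous_on_eq[OF l[OF bl(2)]], simp add: AB_eq)
  moreover have "continuous_on {0..} K" "continuous_on {0..} K'"
    by (rule continuous_at_imp_continuous_on, simp add: DERIV_isCont[OF K(1)])
      (rule continuous_at_imp_continuous_on, simp add: DERIV_isCont[OF K'(1)])
  ultimately have "continuous_on {t0..s0} (\<lambda>r. K (A r))" "continuous_on {t0..s0} (\<lambda>r. K' (B r))"
    using nn(1,3) by (auto intro: continuous_on_compose2)
  then have cont: "continuous_on {t0..s0} \<Phi>"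
    unfolding \<Phi>_def by (rule continuous_on_add)
  have deriv: "(\<Phi> has_vector_derivative conformal_finsler f (\<gamma> r) (vector_derivative \<gamma> (at r within {t0..s0}))) (at r)"
    if r: "r \<in> {t0<..<s0} - S" for r
  proof -
    define y where "y = vector_derivative \<gamma> (at r within {t0..s0})"
    have rI: "r \<in> {t0..s0}" "r \<in> {t0<..<s0}" using r by auto
    have \<gamma>': "((\<lambda>r. \<gamma> r - p) has_vector_derivative y) (at r)"
      using has_vector_derivative_diff[OF S(2)[OF r] has_vector_derivative_const[of p]] by (simp add: y_def)
    have A': "(A has_real_derivative \<sigma> y) (at r)"
      unfolding has_real_derivative_iff_has_vector_derivative
      by (rule has_vector_derivative_transform_within_open[OF
            bounded_linear.has_vector_derivative[OF bl(1) \<gamma>'] open_greaterThanLessThan rI(2)])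
        (simp add: AB_eq)
    have B': "(B has_real_derivative \<tau> y) (at r)"
      unfolding has_real_derivative_iff_has_vector_derivative
      by (rule has_vector_derivative_transform_within_open[OF
            bounded_linear.has_vector_derivative[OF bl(2) \<gamma>'] open_greaterThanLessThan rI(2)])
        (simp add: AB_eq)
    have "0 \<le> \<sigma> y" "0 \<le> \<tau> y"
      using mono_on_imp_deriv_nonneg[OF A(1) A'] mono_on_imp_deriv_nonneg[OF B(1) B'] rI by auto
    then have F: "F0 y = \<sigma> y + \<tau> y"
      using F0_hex_pair[OF vw, of "\<sigma> y" "\<tau> y"] unfolding st(3)[symmetric] by simp
    have "((\<lambda>r. K (A r) + K' (B r)) has_real_derivative
        f (p + A r *\<^sub>R v) * \<sigma> y + f (p + s *\<^sub>R v + B r *\<^sub>R w) * \<tau> y) (at r)"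
      by (rule DERIV_add[OF DERIV_chain2[OF K(1)[OF nn(1)[OF rI(1)]] A']
            DERIV_chain2[OF K'(1)[OF nn(3)[OF rI(1)]] B']])
    \<comment> \<open>The two values of \<open>f\<close> are taken on different legs, but only one
      of them counts: if \<open>B r > 0\<close>, then \<open>A\<close> is maximal and \<sigma> of
      the velocity vanishes; if \<open>B r = 0\<close>, then \<open>B\<close> is minimal and \<tau>
      of it vanishes.\<close>
    moreover have "f (p + A r *\<^sub>R v) * \<sigma> y + f (p + s *\<^sub>R v + B r *\<^sub>R w) * \<tau> y = f (\<gamma> r) * F0 y"
    proof (cases "0 < B r")
      case True
      then have "A r = s" by (rule AB[OF rI(1)])
      moreover have "\<sigma> y = 0"
        by (rule mono_on_extremum_deriv[OF A' rI(2)]) (simp add: nn \<open>A r = s\<close>)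
      ultimately show ?thesis by (simp add: F form[OF rI(1)])
    next
      case False
      then have "B r = 0" using nn(3)[OF rI(1)] by simp
      moreover have "\<tau> y = 0"
        by (rule mono_on_extremum_deriv[OF B' rI(2)]) (simp add: nn \<open>B r = 0\<close>)
      ultimately show ?thesis by (simp add: F form[OF rI(1)])
    qed
    ultimately show ?thesis
      unfolding has_real_derivative_iff_has_vector_derivative \<Phi>_def[abs_def] y_def[symmetric]
      by (simp add: conformal_finsler_def)
  qed
  have "((\<lambda>r. conformal_finsler f (\<gamma> r) (vector_derivative \<gamma> (at r within {t0..s0}))) has_integral
      \<Phi> s0 - \<Phi> t0) {t0..s0}"
    by (rule fundamental_theorem_of_calculus_interior_strong[OF S(1) _ deriv cont]) (use t0s0 in auto)
  then have "finsler_length (conformal_finsler f) \<gamma> t0 s0 = \<Phi> s0 - \<Phi> t0"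
    unfolding finsler_length_def by (rule integral_unique)
  also have "\<dots> = bent_length f p v w s t"
    using K(2)[of s] K'(2)[of t] nn[of s0] t0s0 A B by (simp add: \<Phi>_def bent_length_def)
  finally show ?thesis .
qed

text \<open>The coordinates \<open>A\<close> and \<open>B\<close> describe a \<^const>\<open>linepath\<close> and a join of two of
  them in the same way.\<close>

definition is_bent_path :: "plane \<Rightarrow> plane \<Rightarrow> (real \<Rightarrow> plane) \<Rightarrow> plane \<Rightarrow> plane \<Rightarrow> (real \<Rightarrow> real) \<Rightarrow> (real \<Rightarrow> real) \<Rightarrow> bool" where
  "is_bent_path p q \<sigma> v w A B \<longleftrightarrow> (v, w) \<in> hex_pairs \<and> q = p + A 1 *\<^sub>R v + B 1 *\<^sub>R w \<and>
    continuous_on {0..1} A \<and> continuous_on {0..1} B \<and> mono_on {0..1} A \<and> mono_on {0..1} B \<and>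
    A 0 = 0 \<and> B 0 = 0 \<and> (\<forall>r\<in>{0..1}. 0 < B r \<longrightarrow> A r = A 1) \<and>
    (p \<noteq> q \<longrightarrow> strict_mono_on {0..1} (\<lambda>r. A r + B r)) \<and>
    (\<forall>r\<in>{0..1}. \<sigma> r = p + A r *\<^sub>R v + B r *\<^sub>R w)"

lemma smooth_on_interval_affine:
  assumes "\<And>t. t \<in> {u..v} \<Longrightarrow> \<gamma> t = x + t *\<^sub>R y"
  shows "smooth_on_interval \<gamma> u v"
  unfolding smooth_on_interval_def
proof (intro exI[of _ "\<lambda>n t. if n = 0 then x + t *\<^sub>R y else if n = 1 then y else 0"] conjI allI ballI)
  fix n :: nat and t
  show "((\<lambda>t. if n = 0 then x + t *\<^sub>R y else if n = 1 then y else 0) has_vector_derivative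
      (if Suc n = 0 then x + t *\<^sub>R y else if Suc n = 1 then y else 0)) (at t within {u..v})"
    by (cases "n = 0"; cases "n = 1") (auto intro!: derivative_eq_intros)
qed (simp add: assms)

lemma piecewise_smooth_linepath: "piecewise_smooth (linepath p q) 0 1"
  unfolding piecewise_smooth_def
proof (intro conjI exI[of _ 1] exI[of _ real] allI impI)
  fix i :: nat assume "i < 1"
  show "smooth_on_interval (linepath p q) (real i) (real (Suc i))"
    by (rule smooth_on_interval_affine[of _ _ _ p "q - p"]) (simp add: linepath_def algebra_simps)
qed auto

lemma piecewise_smooth_join_linepath:
  "piecewise_smooth (linepath p a +++ linepath a q) 0 1"
  unfolding piecewise_smooth_def
proof (intro conjI exI[of _ 2] exI[of _ "\<lambda>i. real i / 2"] allI impI)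
  fix i :: nat assume "i < 2"
  then consider "i = 0" | "i = 1" by linarith
  then show "smooth_on_interval (linepath p a +++ linepath a q) (real i / 2) (real (Suc i) / 2)"
  proof cases
    case 1
    show ?thesis
      by (rule smooth_on_interval_affine[of _ _ _ p "2 *\<^sub>R (a - p)"])
        (simp add: 1 joinpaths_def linepath_def algebra_simps)
  next
    case 2
    \<comment> \<open>At 1/2 \<open>joinpaths\<close> takes the value of the first path; the paths
      meet there, so the second formula holds on the closed piece.\<close>
    have j: "(linepath p a +++ linepath a q) t = linepath a q (2 * t - 1)" if "1 / 2 \<le> t" for t
    proof (cases "t = 1 / 2")
      case True
      show ?thesis unfolding True by (simp add: joinpaths_def linepath_def)
    next
      case False
      then show ?thesis using that by (simp add: joinpaths_def)
    qed
    show ?thesis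
      by (rule smooth_on_interval_affine[of _ _ _ "2 *\<^sub>R a - q" "2 *\<^sub>R (q - a)"])
        (simp add: 2 j, simp add: linepath_def algebra_simps scaleR_2)
  qed
qed auto

section \<open>Minimizing paths\<close>

text \<open>\<open>joinpaths\<close> runs through each leg at double speed in its half of the unit
  interval, whence the clipped coordinates.\<close>

lemma is_bent_pathI_corner:
  assumes vw: "(v, w) \<in> hex_pairs" and st: "0 < s" "0 < t" and q: "q = p + s *\<^sub>R v + t *\<^sub>R w"
  shows "is_bent_path p q (linepath p (p + s *\<^sub>R v) +++ linepath (p + s *\<^sub>R v) q) v w
    (\<lambda>r. s * min 1 (2 * r)) (\<lambda>r. t * max 0 (2 * r - 1))"
  unfolding is_bent_path_def
proof (intro conjI ballI impI vw)
  let ?A = "\<lambda>r. s * min 1 (2 * r)" and ?B = "\<lambda>r. t * max 0 (2 * r - 1)"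
  show "mono_on {0..1} ?A" "mono_on {0..1} ?B"
    using st by (auto intro!: mono_onI mult_left_mono)
  show "strict_mono_on {0..1} (\<lambda>r. ?A r + ?B r)"
  proof (rule strict_mono_onI)
    fix r r' :: real assume "r < r'"
    consider "r' \<le> 1 / 2" | "1 / 2 \<le> r" | "r < 1 / 2" "1 / 2 < r'" by linarith
    then show "?A r + ?B r < ?A r' + ?B r'"
    proof cases
      case 1
      then show ?thesis using st \<open>r < r'\<close> by simp
    next
      case 2
      then show ?thesis using st \<open>r < r'\<close> by simp
    next
      case 3
      then have "s * (2 * r) < s * 1" "0 < t * (2 * r' - 1)" using st by simp_all
      then show ?thesis using 3 by simp
    qed
  qed
  show "?A r = ?A 1" if "0 < ?B r" for r
    using that st by (auto simp: zero_less_mult_iff max_def split: if_splits)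
  show "(linepath p (p + s *\<^sub>R v) +++ linepath (p + s *\<^sub>R v) q) r = p + ?A r *\<^sub>R v + ?B r *\<^sub>R w" for r
  proof (cases "r \<le> 1 / 2")
    case True
    then show ?thesis by (simp add: joinpaths_def linepath_def algebra_simps)
  next
    case False
    then show ?thesis unfolding q by (simp add: joinpaths_def linepath_def algebra_simps)
  qed
qed (auto intro!: continuous_intros simp: q)

lemma is_bent_pathI_first:
  assumes vw: "(v, w) \<in> hex_pairs" and "0 \<le> s" and q: "q = p + s *\<^sub>R v"
  shows "is_bent_path p q (linepath p q) v w (\<lambda>r. s * r) (\<lambda>r. 0)"
  unfolding is_bent_path_def
proof (intro conjI ballI impI vw)
  show "strict_mono_on {0..1} (\<lambda>r. s * r + 0)" if "p \<noteq> q"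
    using assms that by (cases "s = 0") (auto intro!: strict_mono_onI)
qed (use assms in \<open>auto intro!: continuous_intros mono_onI mult_left_mono simp: linepath_def algebra_simps\<close>)

lemma is_bent_pathI_second:
  assumes vw: "(v, w) \<in> hex_pairs" and "0 \<le> s" and q: "q = p + s *\<^sub>R w"
  shows "is_bent_path p q (linepath p q) v w (\<lambda>r. 0) (\<lambda>r. s * r)"
  unfolding is_bent_path_def
proof (intro conjI ballI impI vw)
  show "strict_mono_on {0..1} (\<lambda>r. 0 + s * r)" if "p \<noteq> q"
    using assms that by (cases "s = 0") (auto intro!: strict_mono_onI)
qed (use assms in \<open>auto intro!: continuous_intros mono_onI mult_left_mono simp: linepath_def algebra_simps\<close>)

section \<open>From the sector table of \<open>min_path\<close> to \<open>hex_pairs\<close>\<close>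

lemma hex_pairs_table:
  "(v, w) \<in> hex_pairs \<longleftrightarrow> (\<exists>k i j. (k, i, j) \<in> sector_table \<and> v = hour_dir i \<and> w = hour_dir j)"
proof
  assume "(v, w) \<in> hex_pairs"
  then show "\<exists>k i j. (k, i, j) \<in> sector_table \<and> v = hour_dir i \<and> w = hour_dir j"
    unfolding hex_pairs_def sector_table_def hour_dir_even(3-6)[symmetric]
    by (elim insertE emptyE Pair_inject) blast+
next
  assume "\<exists>k i j. (k, i, j) \<in> sector_table \<and> v = hour_dir i \<and> w = hour_dir j"
  then show "(v, w) \<in> hex_pairs"
    unfolding hex_pairs_def sector_table_def
    by (elim exE conjE insertE emptyE Pair_inject) (simp_all add: hour_dir_even(3-6))
qed

lemma sector_table_inj:
  assumes "(k, i, j) \<in> sector_table" "(k', i', j') \<in> sector_table"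
    and "hour_dir i = hour_dir i'" "hour_dir j = hour_dir j'"
  shows "(k, i, j) = (k', i', j')"
proof -
  have "up_coord (hour_dir i) = up_coord (hour_dir i')" "ur_coord (hour_dir i) = ur_coord (hour_dir i')"
    "up_coord (hour_dir j) = up_coord (hour_dir j')" "ur_coord (hour_dir j) = ur_coord (hour_dir j')"
    using assms(3,4) by simp_all
  then show ?thesis using assms(1,2) unfolding sector_table_def
    by (elim insertE emptyE Pair_inject) (simp_all add: hour_dir_even(3-))
qed

text \<open>For \<open>k\<close> equal to 7, 9 or 11 the upper half-line has index
  \<open>k + 1\<close>, so the table lists the directions in the opposite order; for 11 that index
  is 12, which is \<open>up\<close> again.\<close>

lemma sector_eq:
  assumes "(k, i, j) \<in> sector_table"
  shows "sector k p = {p + s *\<^sub>R hour_dir i + t *\<^sub>R hour_dir j | s t. 0 < s \<and> 0 < t}"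
proof -
  define C where "C x y = {p + s *\<^sub>R x + t *\<^sub>R y | s t. 0 < s \<and> 0 < t}" for x y
  have "C x y \<subseteq> C y x" for x y
  proof
    fix z assume "z \<in> C x y"
    then obtain s t where "0 < s" "0 < t" "z = p + s *\<^sub>R x + t *\<^sub>R y" unfolding C_def by blast
    then have "0 < s" "0 < t" "z = p + t *\<^sub>R y + s *\<^sub>R x" by (simp_all add: add.assoc add.commute)
    then show "z \<in> C y x" unfolding C_def by blast
  qed
  then have swap: "C x y = C y x" for x y by blast
  have "hour_dir (k - 1) = hour_dir i \<and> hour_dir (k + 1) = hour_dir j \<or>
     hour_dir (k - 1) = hour_dir j \<and> hour_dir (k + 1) = hour_dir i"
    using assms unfolding sector_table_def by (elim insertE emptyE) (simp_all add: hour_dir_even(7) numeral_2_eq_2)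
  then show ?thesis unfolding sector_def C_def[symmetric] using swap by metis
qed

lemma min_path_is_bent_path:
  obtains v w A B where "is_bent_path p q (min_path p q) v w A B"
proof (cases "p = q \<or> (\<exists>i\<in>{0,2,4,6,8,10}. pos_multiple (q - p) (hour_dir i))")
  case True
  then have m: "min_path p q = linepath p q" by (simp add: min_path_def)
  have "p = q \<or> (\<exists>e\<in>hex_dirs. \<exists>s>0. q = p + s *\<^sub>R e)"
    using True by (auto simp: pos_multiple_def hex_dirs_def hour_dir_even(3-6) algebra_simps)
  then have "\<exists>v w s. (v, w) \<in> hex_pairs \<and> 0 \<le> s \<and> (q = p + s *\<^sub>R v \<or> q = p + s *\<^sub>R w)"
  proof
    assume "p = q"
    then show ?thesis by (intro exI[of _ up] exI[of _ ur] exI[of _ 0]) (simp add: hex_pairs_def)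
  next
    assume "\<exists>e\<in>hex_dirs. \<exists>s>0. q = p + s *\<^sub>R e"
    then obtain e s where "e \<in> hex_dirs" "0 < s" "q = p + s *\<^sub>R e" by blast
    moreover have "\<exists>v w. (v, w) \<in> hex_pairs \<and> (e = v \<or> e = w)"
      using \<open>e \<in> hex_dirs\<close> unfolding hex_dirs_def hex_pairs_def by blast
    ultimately show ?thesis by (metis less_imp_le)
  qed
  then show thesis
    using that[unfolded m] is_bent_pathI_first is_bent_pathI_second by blast
next
  case False
  obtain v w s t where vw: "(v, w) \<in> hex_pairs" and st: "0 \<le> s" "0 \<le> t"
    and d: "q - p = s *\<^sub>R v + t *\<^sub>R w" by (rule hex_pairs_cover)
  have q: "q = p + s *\<^sub>R v + t *\<^sub>R w" using d by (simp add: algebra_simps)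
  have hd: "\<exists>i\<in>{0,2,4,6,8,10}. e = hour_dir i" if "e \<in> hex_dirs" for e
    using that unfolding hex_dirs_def by (auto simp: hour_dir_even(3-6))
  have nm: "\<not> pos_multiple (q - p) e" if "e \<in> hex_dirs" for e
    using False hd[OF that] by blast
  have neq: "q - p \<noteq> 0" using False by auto
  have "s \<noteq> 0"
  proof
    assume "s = 0"
    then have "t \<noteq> 0" using d neq by auto
    then have "pos_multiple (q - p) w"
      unfolding pos_multiple_def using d st \<open>s = 0\<close> by (intro exI[of _ t]) simp
    then show False using nm[OF hex_dirs_pair(3)[OF vw]] by blast
  qed
  moreover have "t \<noteq> 0"
  proof
    assume "t = 0"
    then have "s \<noteq> 0" using d neq by auto
    then have "pos_multiple (q - p) v"
      unfolding pos_multiple_def using d st \<open>t = 0\<close> by (intro exI[of _ s]) simp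
    then show False using nm[OF hex_dirs_pair(2)[OF vw]] by blast
  qed
  ultimately have pos: "0 < s" "0 < t" using st by auto
  obtain k i j where T: "(k, i, j) \<in> sector_table" "v = hour_dir i" "w = hour_dir j"
    using vw unfolding hex_pairs_table by blast
  \<comment> \<open>Positive coordinates determine the pair of directions by
    \<open>hex_sector_unique\<close>, and the pair determines the row of the table.\<close>
  have the1: "(THE (k, i, j). (k, i, j) \<in> sector_table \<and> q \<in> sector k p) = (k, i, j)"
  proof (rule the_equality)
    have "q \<in> sector k p" unfolding sector_eq[OF T(1)] T(2,3)[symmetric] mem_Collect_eq
      by (rule exI[of _ s], rule exI[of _ t]) (simp add: q pos)
    then show "case (k, i, j) of (k, i, j) \<Rightarrow> (k, i, j) \<in> sector_table \<and> q \<in> sector k p"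
      using T(1) by simp
    fix x assume x: "case x of (k, i, j) \<Rightarrow> (k, i, j) \<in> sector_table \<and> q \<in> sector k p"
    obtain k' i' j' where x': "x = (k', i', j')" by (cases x)
    then have T': "(k', i', j') \<in> sector_table" "q \<in> sector k' p" using x by auto
    obtain s' t' where s': "0 < s'" "0 < t'" "q = p + s' *\<^sub>R hour_dir i' + t' *\<^sub>R hour_dir j'"
      using T'(2) unfolding sector_eq[OF T'(1)] mem_Collect_eq by (elim exE conjE)
    have "(hour_dir i', hour_dir j') \<in> hex_pairs"
      unfolding hex_pairs_table by (rule exI[of _ k'], rule exI[of _ i'], rule exI[of _ j']) (simp add: T'(1))
    note unique = hex_sector_unique[OF vw this pos s'(1,2)]
    have "v = hour_dir i' \<and> w = hour_dir j'"
    proof (rule unique)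
      show "s *\<^sub>R v + t *\<^sub>R w = s' *\<^sub>R hour_dir i' + t' *\<^sub>R hour_dir j'"
        using trans[OF q[symmetric] s'(3)] by (simp only: add.assoc add_left_cancel)
    qed
    then show "x = (k, i, j)" unfolding x' by (intro sector_table_inj[OF T'(1) T(1)]) (simp_all flip: T(2,3))
  qed
  have the2: "(THE a. a \<in> full_line i p \<and> a \<in> full_line j q) = p + s *\<^sub>R v"
  proof (rule the_equality)
    have "p + s *\<^sub>R v = q + (- t) *\<^sub>R w" using q by simp
    then have "\<exists>x. p + s *\<^sub>R v = q + x *\<^sub>R w" by (rule exI)
    moreover have "\<exists>x. p + s *\<^sub>R v = p + x *\<^sub>R v" by (rule exI) (rule refl)
    ultimately show "p + s *\<^sub>R v \<in> full_line i p \<and> p + s *\<^sub>R v \<in> full_line j q"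
      unfolding full_line_def T(2,3)[symmetric] mem_Collect_eq simp_thms by (intro conjI)
    fix a assume "a \<in> full_line i p \<and> a \<in> full_line j q"
    then have "(\<exists>x. a = p + x *\<^sub>R v) \<and> (\<exists>y. a = q + y *\<^sub>R w)"
      unfolding full_line_def T(2,3)[symmetric] mem_Collect_eq by simp
    then obtain x y where a: "a = p + x *\<^sub>R v" "a = q + y *\<^sub>R w" by (elim conjE exE)
    have "p + x *\<^sub>R v = p + s *\<^sub>R v + t *\<^sub>R w + y *\<^sub>R w"
      using trans[OF a(1)[symmetric] a(2)] unfolding q .
    then have "x *\<^sub>R v + 0 *\<^sub>R w = s *\<^sub>R v + (t + y) *\<^sub>R w"
      by (simp add: scaleR_left_distrib add.assoc)
    then have "x = s" by (rule hex_pairs_independent(1)[OF vw])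
    then show "a = p + s *\<^sub>R v" using a(1) by simp
  qed
  have "min_path p q = linepath p (p + s *\<^sub>R v) +++ linepath (p + s *\<^sub>R v) q"
    unfolding min_path_def if_not_P[OF False] the1 by (simp add: the2 Let_def)
  then show thesis using that is_bent_pathI_corner[OF vw pos q] by simp
qed

lemma piecewise_smooth_min_path: "piecewise_smooth (min_path p q) 0 1"
  unfolding min_path_def
  by (simp add: Let_def piecewise_smooth_linepath piecewise_smooth_join_linepath split: prod.split)

section \<open>Distance and parameter along a bent path\<close>

context
  fixes p q :: plane and \<sigma> v w A B
  assumes bent: "is_bent_path p q \<sigma> v w A B"
begin

lemma bent_path_facts:
  shows "(v, w) \<in> hex_pairs" "q = p + A 1 *\<^sub>R v + B 1 *\<^sub>R w" "A 0 = 0" "B 0 = 0"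
    and "continuous_on {0..1} A" "continuous_on {0..1} B" "mono_on {0..1} A" "mono_on {0..1} B"
    and "r \<in> {0..1} \<Longrightarrow> 0 < B r \<Longrightarrow> A r = A 1"
    and "p \<noteq> q \<Longrightarrow> strict_mono_on {0..1} (\<lambda>r. A r + B r)"
    and "r \<in> {0..1} \<Longrightarrow> \<sigma> r = p + A r *\<^sub>R v + B r *\<^sub>R w"
  using bent unfolding is_bent_path_def by auto

lemma bent_path_nonneg:
  assumes "r \<in> {0..1}"
  shows "0 \<le> A r" "A r \<le> A 1" "0 \<le> B r" "B r \<le> B 1"
  using mono_onD[OF bent_path_facts(7), of 0 r] mono_onD[OF bent_path_facts(7), of r 1]
    mono_onD[OF bent_path_facts(8), of 0 r] mono_onD[OF bent_path_facts(8), of r 1] assms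
  by (simp_all add: bent_path_facts(3,4))

lemma bent_path_ends: "\<sigma> 0 = p" "\<sigma> 1 = q"
  using bent_path_facts(2,3,4) bent_path_facts(11)[of 0] bent_path_facts(11)[of 1] by simp_all

lemma bent_dist_eq_bent_length: "bent_dist f p q = bent_length f p v w (A 1) (B 1)"
  using bent_dist_eq[OF bent_path_facts(1), of "A 1" "B 1" f p] bent_path_facts(2)
    bent_path_nonneg[of 1] by simp

text \<open>By the intermediate value theorem \<open>A + B\<close> takes the value
  \<open>s' + t'\<close>. The sum determines both coordinates, because \<open>B\<close> is positive
  only where \<open>A\<close> has reached its final value.\<close>

lemma on_bent_imp_on_path:
  assumes "on_bent p x q"
  obtains r where "r \<in> {0..1}" "x = \<sigma> r"
proof -
  note nn = bent_path_nonneg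
  obtain s' t' where x: "0 \<le> s'" "s' \<le> A 1" "0 \<le> t'" "t' \<le> B 1" "0 < t' \<Longrightarrow> s' = A 1"
    "x = p + s' *\<^sub>R v + t' *\<^sub>R w"
    using on_bentE[OF assms bent_path_facts(1) _ _ bent_path_facts(2)] nn[of 1] by auto
  have "\<exists>r\<ge>0. r \<le> 1 \<and> A r + B r = s' + t'"
    by (rule IVT') (use x bent_path_facts(3-6) in \<open>auto intro!: continuous_intros\<close>)
  then obtain r where r: "r \<in> {0..1}" "A r + B r = s' + t'" by auto
  have "A r = s'"
  proof (cases "0 < B r")
    case True
    then have "A r = A 1" by (rule bent_path_facts(9)[OF r(1)])
    then show ?thesis using x(2,5) r(2) True by (cases "0 < t'") linarith+
  next
    case False
    then have "B r = 0" using nn(3)[OF r(1)] by linarith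
    then show ?thesis using x(3,5) r(2) nn(2)[OF r(1)] by (cases "0 < t'") linarith+
  qed
  then have "A r = s' \<and> B r = t'" using r(2) by simp
  then show thesis using that[OF r(1)] x(6) bent_path_facts(11)[OF r(1)] by simp
qed

text \<open>The parameter change need not be differentiable, so no chain rule is applied to it;
  composed with it, \<open>A\<close> and \<open>B\<close> remain monotone, and
  \<open>length_of_bent_path\<close> takes the smoothness from \<gamma>.\<close>

lemma length_of_reparam:
  assumes f: "continuous_on UNIV f" and pw: "piecewise_smooth \<gamma> t0 s0"
    and re: "monotone_reparam_of \<gamma> t0 s0 \<sigma> 0 1"
  shows "finsler_length (conformal_finsler f) \<gamma> t0 s0 = bent_dist f p q"
proof -
  have t0s0: "t0 < s0" using pw by (simp add: piecewise_smooth_def)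
  obtain \<phi> :: "real \<Rightarrow> real" where \<phi>: "mono_on {t0..s0} \<phi>" "\<phi> ` {t0..s0} = {0..1}"
    "\<forall>t\<in>{t0..s0}. \<gamma> t = \<sigma> (\<phi> t)"
    using re unfolding monotone_reparam_of_def by (elim exE conjE)
  have I: "\<phi> t \<in> {0..1}" if "t \<in> {t0..s0}" for t using \<phi>(2) that by blast
  have "0 \<in> \<phi> ` {t0..s0}" "1 \<in> \<phi> ` {t0..s0}" unfolding \<phi>(2) by simp_all
  then obtain x y where xy: "x \<in> {t0..s0}" "\<phi> x = 0" "y \<in> {t0..s0}" "\<phi> y = 1"
    by (elim imageE) simp
  have ends: "\<phi> t0 = 0" "\<phi> s0 = 1"
    using mono_onD[OF \<phi>(1), of t0 x] mono_onD[OF \<phi>(1), of y s0] xy I[of t0] I[of s0] t0s0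
    by simp_all
  have mono: "mono_on {t0..s0} (\<lambda>t. C (\<phi> t))" if "mono_on {0..1} C" for C :: "real \<Rightarrow> real"
    using that \<phi>(1) I by (simp add: mono_on_def)
  show ?thesis
    unfolding bent_dist_eq_bent_length
  proof (rule length_of_bent_path[OF f pw bent_path_facts(1)])
    show "mono_on {t0..s0} (\<lambda>t. A (\<phi> t))" "mono_on {t0..s0} (\<lambda>t. B (\<phi> t))"
      by (rule mono, rule bent_path_facts)+
    show "\<gamma> t = p + A (\<phi> t) *\<^sub>R v + B (\<phi> t) *\<^sub>R w" if "t \<in> {t0..s0}" for t
      using bent_path_facts(11)[OF I[OF that]] \<phi>(3) that by simp
    show "A (\<phi> t) = A 1" if "t \<in> {t0..s0}" "0 < B (\<phi> t)" for t
      by (rule bent_path_facts(9)[OF I[OF that(1)] that(2)])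
  qed (simp_all add: ends bent_path_facts(3,4))
qed

lemma bent_dist_along_path:
  assumes f: "continuous_on UNIV f" and gt: "\<And>z. 1 < f z"
  shows "continuous_on {0..1} (\<lambda>r. bent_dist f p (\<sigma> r))"
    and "p \<noteq> q \<Longrightarrow> strict_mono_on {0..1} (\<lambda>r. bent_dist f p (\<sigma> r))"
proof -
  note nn = bent_path_nonneg
  \<comment> \<open>The second term always starts at the corner; this is correct before the corner
    too, since \<open>B r = 0\<close> there.\<close>
  define \<rho> where "\<rho> r = seg_length f p v (A r) + seg_length f (p + A 1 *\<^sub>R v) w (B r)" for r
  have \<rho>: "bent_dist f p (\<sigma> r) = \<rho> r" if "r \<in> {0..1}" for r
  proof -
    have "bent_dist f p (\<sigma> r) = bent_length f p v w (A r) (B r)"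
      using bent_dist_eq[OF bent_path_facts(1), of "A r" "B r" f p] nn[OF that]
        bent_path_facts(11)[OF that] by simp
    then show ?thesis using nn(3)[OF that] bent_path_facts(9)[OF that]
      by (cases "0 < B r") (auto simp: bent_length_def \<rho>_def)
  qed
  have seg: "continuous_on {0..1} (\<lambda>r. seg_length f z e (C r))"
    if "continuous_on {0..1} C" "\<And>r. r \<in> {0..1} \<Longrightarrow> 0 \<le> C r" for C :: "real \<Rightarrow> real" and z e
  proof -
    obtain K where "\<forall>h\<ge>0. (K has_real_derivative f (z + h *\<^sub>R e)) (at h)"
      "\<forall>h\<ge>0. seg_length f z e h = K h - K 0"
      using seg_length_antiderivative[OF f, of z e] by (elim exE conjE)
    note K = this[rule_format]
    have "continuous_on {0..} K"
      by (rule continuous_at_imp_continuous_on, simp add: DERIV_isCont[OF K(1)])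
    then have "continuous_on {0..1} (\<lambda>r. K (C r))"
      by (rule continuous_on_compose2[OF _ that(1)]) (use that(2) in auto)
    then have "continuous_on {0..1} (\<lambda>r. K (C r) - K 0)" by (intro continuous_intros)
    then show ?thesis by (rule continuous_on_eq) (simp add: K(2) that(2))
  qed
  have "continuous_on {0..1} \<rho>" unfolding \<rho>_def
    by (rule continuous_on_add[OF seg[OF bent_path_facts(5) nn(1)] seg[OF bent_path_facts(6) nn(3)]])
  then show "continuous_on {0..1} (\<lambda>r. bent_dist f p (\<sigma> r))"
    by (rule continuous_on_eq) (simp add: \<rho>)
  show "strict_mono_on {0..1} (\<lambda>r. bent_dist f p (\<sigma> r))" if "p \<noteq> q"
  proof (rule strict_mono_onI)
    fix r r' :: real assume r: "r \<in> {0..1}" "r' \<in> {0..1}" "r < r'"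
    have seg_mono: "seg_length f z e h < seg_length f z e h'" if "0 \<le> h" "h < h'" for z e h h'
      using seg_length_add[OF f, of h "h' - h" z e] that
        seg_length_greater[OF f _ gt, of "h' - h" "z + h *\<^sub>R e" e] by simp
    have "A r \<le> A r'" "B r \<le> B r'"
      using mono_onD[OF bent_path_facts(7) r(1,2)] mono_onD[OF bent_path_facts(8) r(1,2)] r(3) by auto
    moreover have "A r + B r < A r' + B r'"
      using strict_mono_onD[OF bent_path_facts(10)[OF that] r] .
    ultimately consider "A r < A r'" "B r < B r'" | "A r < A r'" "B r = B r'" | "A r = A r'" "B r < B r'"
      by linarith
    then have "\<rho> r < \<rho> r'"
      unfolding \<rho>_def using nn(1,3)[OF r(1)]
      by cases (simp_all add: seg_mono add_strict_mono)
    then show "bent_dist f p (\<sigma> r) < bent_dist f p (\<sigma> r')" using \<rho> r by simp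
  qed
qed

end

text \<open>Cutting a minimizer at time \<open>t\<close> gives equality in the triangle inequality.
  Hence its point lies on the bent path, and the length \<Lambda> run so far is the distance of that
  point from \<open>p\<close>. This distance increases strictly along \<sigma> when \<open>p\<close>
  and \<open>q\<close> differ, so its inverse \<psi> recovers the parameter as
  \<open>\<psi> (\<Lambda> t)\<close>, continuous and monotone because \<Lambda> is.\<close>

lemma (in hex_plane) minimal_imp_reparam:
  assumes bent: "is_bent_path p q \<sigma> v w A B" and path: "path_from_to p q \<gamma> t0 s0"
    and len: "finsler_length (conformal_finsler f) \<gamma> t0 s0 = bent_dist f p q"
  shows "monotone_reparam_of \<gamma> t0 s0 \<sigma> 0 1"
proof -
  have pw: "piecewise_smooth \<gamma> t0 s0" and e: "\<gamma> t0 = p" "\<gamma> s0 = q"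
    using path unfolding path_from_to_def by auto
  have t0s0: "t0 < s0" using pw by (simp add: piecewise_smooth_def)
  define g where "g t = conformal_finsler f (\<gamma> t) (vector_derivative \<gamma> (at t within {t0..s0}))" for t
  define \<Lambda> where "\<Lambda> t = integral {t0..t} g" for t
  have g: "g integrable_on {t0..s0}"
    unfolding g_def by (rule F0_velocity_integrable(2)[OF pw cont]) auto
  have tot: "integral {t0..s0} g = bent_dist f p q"
    using len by (simp add: finsler_length_def g_def[abs_def])
  have split: "\<Lambda> t = bent_dist f p (\<gamma> t) \<and> on_bent p (\<gamma> t) q" if t: "t \<in> {t0..s0}" for t
  proof -
    have "bent_dist f p (\<gamma> t) \<le> \<Lambda> t"
      using bent_dist_le_length[OF pw, of t0 t p] t e by (simp add: \<Lambda>_def g_def[abs_def])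
    moreover have "bent_dist f (\<gamma> t) q \<le> integral {t..s0} g"
      using bent_dist_le_length[OF pw, of t s0 "\<gamma> t"] t e by (simp add: g_def[abs_def])
    moreover have "\<Lambda> t + integral {t..s0} g = bent_dist f p q"
      unfolding \<Lambda>_def tot[symmetric]
      by (rule Henstock_Kurzweil_Integration.integral_combine) (use t g in auto)
    ultimately show ?thesis
      using bent_dist_triangle[of p q "\<gamma> t"] by linarith
  qed
  have on: "\<exists>r\<in>{0..1}. \<gamma> t = \<sigma> r" if "t \<in> {t0..s0}" for t
    using on_bent_imp_on_path[OF bent] split[OF that] by metis
  show ?thesis
  proof (cases "p = q")
    case True
    have "A 1 *\<^sub>R v + B 1 *\<^sub>R w = 0 *\<^sub>R v + 0 *\<^sub>R w"
      using bent_path_facts(2)[OF bent] True by (simp add: add.assoc)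
    then have "A 1 = 0" "B 1 = 0" using hex_pairs_independent[OF bent_path_facts(1)[OF bent]] by blast+
    then have \<sigma>: "\<sigma> r = p" if "r \<in> {0..1}" for r
      using bent_path_nonneg[OF bent that] bent_path_facts(11)[OF bent that] by simp
    \<comment> \<open>Here \<sigma> is constant, so any monotone map onto the unit interval serves;
      the affine one is taken.\<close>
    show ?thesis unfolding monotone_reparam_of_def
    proof (intro exI[of _ "\<lambda>t. (t - t0) / (s0 - t0)"] conjI ballI)
      show "continuous_on {t0..s0} (\<lambda>t. (t - t0) / (s0 - t0))"
        using t0s0 by (intro continuous_intros) auto
      show "mono_on {t0..s0} (\<lambda>t. (t - t0) / (s0 - t0))"
        using t0s0 by (intro mono_onI divide_right_mono) auto
      show "(\<lambda>t. (t - t0) / (s0 - t0)) ` {t0..s0} = {0..1}"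
      proof
        show "{0..1} \<subseteq> (\<lambda>t. (t - t0) / (s0 - t0)) ` {t0..s0}"
        proof
          fix r :: real assume r: "r \<in> {0..1}"
          then have "0 \<le> r * (s0 - t0)" "r * (s0 - t0) \<le> s0 - t0"
            using t0s0 mult_right_mono[of r 1 "s0 - t0"] by simp_all
          then have m: "t0 + r * (s0 - t0) \<in> {t0..s0}" unfolding atLeastAtMost_iff by linarith
          show "r \<in> (\<lambda>t. (t - t0) / (s0 - t0)) ` {t0..s0}"
            by (rule image_eqI[OF _ m]) (use t0s0 in simp)
        qed
      qed (use t0s0 in auto)
      fix t assume t: "t \<in> {t0..s0}"
      then have "(t - t0) / (s0 - t0) \<in> {0..1}" using t0s0 by auto
      then show "\<gamma> t = \<sigma> ((t - t0) / (s0 - t0))" using on[OF t] \<sigma> by metis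
    qed
  next
    case False
    define \<rho> where "\<rho> r = bent_dist f p (\<sigma> r)" for r
    have \<rho>: "continuous_on {0..1} \<rho>" "strict_mono_on {0..1} \<rho>"
      unfolding \<rho>_def using bent_dist_along_path[OF bent cont gt_1] False by blast+
    have inj: "inj_on \<rho> {0..1}" using \<rho>(2) by (rule strict_mono_on_imp_inj_on)
    define \<psi> where "\<psi> = inv_into {0..1} \<rho>"
    have \<psi>\<rho>: "\<psi> (\<rho> r) = r" if "r \<in> {0..1}" for r
      unfolding \<psi>_def by (rule inv_into_f_f[OF inj that])
    have c\<psi>: "continuous_on (\<rho> ` {0..1}) \<psi>"
      by (rule continuous_on_inv[OF \<rho>(1)]) (use \<psi>\<rho> in auto)
    have param: "\<psi> (\<Lambda> t) \<in> {0..1} \<and> \<rho> (\<psi> (\<Lambda> t)) = \<Lambda> t \<and> \<gamma> t = \<sigma> (\<psi> (\<Lambda> t))"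
      if t: "t \<in> {t0..s0}" for t
    proof -
      obtain r where r: "r \<in> {0..1}" "\<gamma> t = \<sigma> r" using on[OF t] by blast
      then have "\<Lambda> t = \<rho> r" using split[OF t] by (simp add: \<rho>_def)
      then show ?thesis using \<psi>\<rho>[OF r(1)] r by simp
    qed
    have \<Lambda>: "continuous_on {t0..s0} \<Lambda>"
      unfolding \<Lambda>_def by (rule indefinite_integral_continuous_1[OF g])
    have "\<Lambda> ` {t0..s0} \<subseteq> \<rho> ` {0..1}"
    proof
      fix y assume "y \<in> \<Lambda> ` {t0..s0}"
      then obtain t where "t \<in> {t0..s0}" "y = \<Lambda> t" by blast
      then show "y \<in> \<rho> ` {0..1}" using param[of t] by force
    qed
    then have c: "continuous_on {t0..s0} (\<lambda>t. \<psi> (\<Lambda> t))"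
      by (rule continuous_on_compose2[OF c\<psi> \<Lambda>])
    have "\<Lambda> t0 = \<rho> 0" "\<Lambda> s0 = \<rho> 1"
      using tot by (simp_all add: \<Lambda>_def \<rho>_def bent_path_ends[OF bent])
    then have ends: "\<psi> (\<Lambda> t0) = 0" "\<psi> (\<Lambda> s0) = 1" by (simp_all add: \<psi>\<rho>)
    show ?thesis unfolding monotone_reparam_of_def
    proof (intro exI[of _ "\<lambda>t. \<psi> (\<Lambda> t)"] conjI ballI c)
      show "mono_on {t0..s0} (\<lambda>t. \<psi> (\<Lambda> t))"
      proof (rule mono_onI)
        fix r s assume rs: "r \<in> {t0..s0}" "s \<in> {t0..s0}" "r \<le> s"
        have "\<Lambda> r + integral {r..s} g = \<Lambda> s"
          unfolding \<Lambda>_def by (rule Henstock_Kurzweil_Integration.integral_combine)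
            (use rs integrable_on_subinterval[OF g] in auto)
        moreover have "0 \<le> integral {r..s} g"
        proof (rule integral_nonneg)
          show "g integrable_on {r..s}" by (rule integrable_on_subinterval[OF g]) (use rs in auto)
          show "0 \<le> g t" for t
            using gt_1[of "\<gamma> t"] F0_norm(1) by (simp add: g_def conformal_finsler_def)
        qed
        ultimately have "\<rho> (\<psi> (\<Lambda> r)) \<le> \<rho> (\<psi> (\<Lambda> s))" using param rs by simp
        then show "\<psi> (\<Lambda> r) \<le> \<psi> (\<Lambda> s)"
          using strict_mono_onD[OF \<rho>(2), of "\<psi> (\<Lambda> s)" "\<psi> (\<Lambda> r)"] param rs by force
      qed
      show "(\<lambda>t. \<psi> (\<Lambda> t)) ` {t0..s0} = {0..1}"
      proof
        show "(\<lambda>t. \<psi> (\<Lambda> t)) ` {t0..s0} \<subseteq> {0..1}" using param by blast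
        show "{0..1} \<subseteq> (\<lambda>t. \<psi> (\<Lambda> t)) ` {t0..s0}"
        proof
          fix r :: real assume "r \<in> {0..1}"
          then have "\<exists>t\<ge>t0. t \<le> s0 \<and> \<psi> (\<Lambda> t) = r"
            by (intro IVT'[OF _ _ _ c]) (use ends t0s0 in auto)
          then show "r \<in> (\<lambda>t. \<psi> (\<Lambda> t)) ` {t0..s0}" by auto
        qed
      qed
    qed (use param in blast)
  qed
qed

section \<open>The trapezoid constant\<close>

lemma norm_derivative_affine_piece:
  fixes \<gamma> :: "real \<Rightarrow> plane"
  assumes u: "0 \<le> u" "u \<le> v" "v \<le> 1" and \<gamma>: "\<And>t. u < t \<Longrightarrow> t < v \<Longrightarrow> \<gamma> t = x + t *\<^sub>R y"
  shows "((\<lambda>t. norm (vector_derivative \<gamma> (at t within {0..1}))) has_integral (v - u) * norm y) {u..v}"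
proof (rule has_integral_spike_finite[of "{u, v}"])
  show "((\<lambda>t. norm y) has_integral (v - u) * norm y) {u..v}"
    using has_integral_const_real[of "norm y" u v] u by simp
  fix t assume t: "t \<in> {u..v} - {u, v}"
  have "((\<lambda>t. x + t *\<^sub>R y) has_vector_derivative y) (at t)"
    by (auto intro!: derivative_eq_intros)
  then have "(\<gamma> has_vector_derivative y) (at t)"
    by (rule has_vector_derivative_transform_within_open[of _ _ _ "{u<..<v}"]) (use t \<gamma> in auto)
  moreover have "at t within {0..1} = at t" using t u by (intro at_within_Icc_at) auto
  ultimately show "norm (vector_derivative \<gamma> (at t within {0..1})) = norm y"
    by (simp add: vector_derivative_at)
qed simp

lemma euclidean_length_linepath: "euclidean_length (linepath x y) = norm (y - x)"
  using norm_derivative_affine_piece[of 0 1 "linepath x y" x "y - x"]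
  by (simp add: euclidean_length_def finsler_length_def integral_unique linepath_def algebra_simps)

lemma euclidean_length_linepaths:
  "euclidean_length (linepath d a +++ linepath a b +++ linepath b c)
    = norm (a - d) + norm (b - a) + norm (c - b)"
proof -
  let ?\<gamma> = "linepath d a +++ linepath a b +++ linepath b c"
  let ?n = "\<lambda>t. norm (vector_derivative ?\<gamma> (at t within {0..1}))"
  \<comment> \<open>\<open>+++\<close> associates to the right: the first segment occupies half of
    the interval and the others a quarter each, so the velocities are multiplied by 2, 4 and
    4.\<close>
  have \<gamma>: "t < 1 / 2 \<Longrightarrow> ?\<gamma> t = d + t *\<^sub>R (2 *\<^sub>R (a - d))"
    "1 / 2 < t \<Longrightarrow> t < 3 / 4 \<Longrightarrow> ?\<gamma> t = (a - 2 *\<^sub>R (b - a)) + t *\<^sub>R (4 *\<^sub>R (b - a))"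
    "3 / 4 < t \<Longrightarrow> ?\<gamma> t = (b - 3 *\<^sub>R (c - b)) + t *\<^sub>R (4 *\<^sub>R (c - b))" for t
    by (simp_all add: joinpaths_def linepath_def prod_eq_iff algebra_simps)
  have 1: "(?n has_integral norm (a - d)) {0..1/2}"
    using norm_derivative_affine_piece[of 0 "1 / 2", OF _ _ _ \<gamma>(1)] by simp
  have 2: "(?n has_integral norm (b - a)) {1/2..3/4}"
    using norm_derivative_affine_piece[of "1 / 2" "3 / 4", OF _ _ _ \<gamma>(2)] by simp
  have 3: "(?n has_integral norm (c - b)) {3/4..1}"
    using norm_derivative_affine_piece[of "3 / 4" 1, OF _ _ _ \<gamma>(3)] by simp
  have "(?n has_integral norm (a - d) + norm (b - a) + norm (c - b)) {0..1}"
    by (rule has_integral_combine[OF _ _ has_integral_combine[OF _ _ 1 2] 3]) simp_all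
  then show ?thesis by (simp add: euclidean_length_def finsler_length_def integral_unique)
qed

lemma cone_aboveI:
  assumes "0 < r" "0 \<le> \<alpha>" "\<alpha> \<le> \<theta>" "\<alpha> \<le> pi" and y: "y - x = r *\<^sub>R (e * sin \<alpha>, cos \<alpha>)" and "e = 1 \<or> e = - 1"
  shows "y \<in> cone_above \<theta> x"
proof -
  have "(e * sin \<alpha>)\<^sup>2 + (cos \<alpha>)\<^sup>2 = 1"
    using assms(6) by (auto simp: power_mult_distrib)
  then have n: "norm (e * sin \<alpha>, cos \<alpha>) = 1" by (simp add: norm_Pair)
  then have "norm (y - x) = r" using assms(1) unfolding y norm_scaleR by simp
  moreover have "inner (y - x) (0, 1) = r * cos \<alpha>" unfolding y by (simp add: inner_Pair)
  ultimately have "euclidean_angle (y - x) (0, 1) = arccos (cos \<alpha>)"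
    using assms(1) by (simp add: euclidean_angle_def norm_Pair)
  also have "\<dots> = \<alpha>" using assms(2,4) by (rule arccos_cos)
  finally show ?thesis using \<open>norm (y - x) = r\<close> assms(1,3) by (auto simp: cone_above_def)
qed

text \<open>The constant is \<open>s3 / s2\<close>, the ratio of \<open>[c, d]\<close> to
  \<open>[b, c]\<close>. The directions \<open>ur\<close> and \<open>up - ur\<close> make the angle
  \<open>pi / 3\<close> with \<open>up\<close> and so lie in the cone; the shift properties come
  from the diagonal and its mirror image, which lie on its boundary.\<close>

lemma trapezoid_hex_plane:
  assumes \<theta>: "pi / 3 < \<theta>" "\<theta> \<le> pi / 2" and trap: "trapezoid \<theta> a b c d"
    and f: "continuous_on UNIV f" and dec: "\<And>x y. y \<in> cone_above \<theta> x \<Longrightarrow> f y < f x"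
    and rng: "\<And>x. f x \<in> {1<..<trapezoid_ratio a b c d}"
  obtains k where "hex_plane f k"
proof -
  obtain s1 s2 s3 s4 s5 where s: "0 < s1" "0 < s2" "0 < s3" "0 < s4" "0 < s5"
    and ba: "b - a = s1 *\<^sub>R (- ur)" and cb: "c - b = s2 *\<^sub>R (- up)" and dc: "d - c = s3 *\<^sub>R ur"
    and ad: "a - d = s4 *\<^sub>R (up - ur)" and db: "d - b = s5 *\<^sub>R (sin \<theta>, cos \<theta>)"
    using trap unfolding trapezoid_def pos_multiple_def hour_dir_even(3-6) by (elim conjE exE)
  have sum: "(b - a) + (c - b) + (d - c) + (a - d) = 0" by simp
  \<comment> \<open>Closing the trapezoid gives \<open>s4 = s2\<close> and
    \<open>s3 = s1 + s4\<close>, so the three other sides together are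
    \<open>s3 + s2\<close>.\<close>
  have s42: "s4 = s2" and s13: "s1 + s4 = s3"
    using arg_cong[OF sum, of up_coord] arg_cong[OF sum, of ur_coord] unfolding ba cb dc ad by simp_all
  have n: "norm up = 1" "norm ur = 1" "norm (up - ur) = 1"
    by (rule norm_hex_dirs, simp add: hex_dirs_def)+
  have "trapezoid_ratio a b c d = (s4 + s1 + s2) / s3"
    unfolding trapezoid_ratio_def euclidean_length_linepath euclidean_length_linepaths ba cb dc ad
    using s n by simp
  also have "\<dots> = 1 + 1 / (s3 / s2)" using s s42 s13 by (simp add: field_simps)
  finally have L: "trapezoid_ratio a b c d = 1 + 1 / (s3 / s2)" .
  have "d - b = (d - c) + (c - b)" by simp
  then have w: "s3 * (sqrt 3 / 2) = s5 * sin \<theta>" "s3 / 2 - s2 = s5 * cos \<theta>"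
    unfolding db dc cb by (simp_all add: hour_dir_even(1,2))
  have dec': "f (z + h *\<^sub>R e) < f z" if "0 < h" "0 \<le> \<alpha>" "\<alpha> \<le> \<theta>"
    "e = (\<sigma> * sin \<alpha>, cos \<alpha>)" "\<sigma> = 1 \<or> \<sigma> = - 1" for z h e \<alpha> and \<sigma> :: real
    by (rule dec, rule cone_aboveI[of h \<alpha>]) (use that \<theta> pi_gt_zero in auto)
  have "hex_plane f (s3 / s2)"
  proof (unfold_locales)
    fix z and h :: real assume h: "0 < h"
    show "f (z + h *\<^sub>R up) < f z"
      by (rule dec'[OF h, of 0 _ 1]) (use \<theta> pi_gt_zero in \<open>simp_all add: hour_dir_even(1)\<close>)
    show "f (z + h *\<^sub>R ur) < f z"
      by (rule dec'[OF h, of "pi / 3" _ 1]) (use \<theta> pi_gt_zero in \<open>simp_all add: hour_dir_even(2) sin_60 cos_60\<close>)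
    show "f (z + h *\<^sub>R (up - ur)) < f z"
      by (rule dec'[OF h, of "pi / 3" _ "- 1"])
        (use \<theta> pi_gt_zero in \<open>simp_all add: hour_dir_even(1,2) sin_60 cos_60\<close>)
    \<comment> \<open>The trapezoid is scaled by \<open>h / s2\<close>: \<open>[c, b]\<close>
      becomes \<open>h *\<^sub>R up\<close> and the diagonal gets length \<open>r\<close>.\<close>
    define r where "r = h * s5 / s2"
    have r: "0 < r" using h s by (simp add: r_def)
    have w': "h * s3 * (sqrt 3 / 2) / s2 = r * sin \<theta>" "h * s3 / s2 / 2 - h = r * cos \<theta>"
      using arg_cong[OF w(1), of "\<lambda>x. h / s2 * x"] arg_cong[OF w(2), of "\<lambda>x. h / s2 * x"] s
      by (simp_all add: r_def right_diff_distrib mult_ac)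
    have "f (z + h *\<^sub>R up + r *\<^sub>R (1 * sin \<theta>, cos \<theta>)) < f (z + h *\<^sub>R up)"
      by (rule dec'[OF r, of \<theta> _ 1]) (use \<theta> pi_gt_zero in auto)
    moreover have "h *\<^sub>R up + r *\<^sub>R (1 * sin \<theta>, cos \<theta>) = (s3 / s2 * h) *\<^sub>R ur"
      using w' by (simp add: hour_dir_even(1,2) prod_eq_iff field_simps)
    ultimately show "f (z + (s3 / s2 * h) *\<^sub>R ur) < f (z + h *\<^sub>R up)" by (simp add: add.assoc)
    have "f (z + h *\<^sub>R up + r *\<^sub>R (- 1 * sin \<theta>, cos \<theta>)) < f (z + h *\<^sub>R up)"
      by (rule dec'[OF r, of \<theta> _ "- 1"]) (use \<theta> pi_gt_zero in auto)
    moreover have "h *\<^sub>R up + r *\<^sub>R (- 1 * sin \<theta>, cos \<theta>) = (s3 / s2 * h) *\<^sub>R (up - ur)"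
      using w' by (simp add: hour_dir_even(1,2) prod_eq_iff field_simps)
    ultimately show "f (z + (s3 / s2 * h) *\<^sub>R (up - ur)) < f (z + h *\<^sub>R up)" by (simp add: add.assoc)
  qed (use f rng s L in auto)
  then show thesis by (rule that)
qed

theorem theorem7p7:
  fixes \<theta> :: real and a b c d :: plane and f :: "plane \<Rightarrow> real" and p q :: plane
  assumes "pi / 3 < \<theta>" and "\<theta> \<le> pi / 2"
    and "trapezoid \<theta> a b c d"
    and "continuous_on UNIV f"
    and "\<And>x. 0 < f x"
    and "\<And>x y. y \<in> cone_above \<theta> x \<Longrightarrow> f y < f x"
    and "\<And>x. f x \<in> {1<..<trapezoid_ratio a b c d}"
  shows "minimizing_path (conformal_finsler f) p q (min_path p q) 0 1 \<and>
    (\<forall>\<gamma> t0 s0. minimizing_path (conformal_finsler f) p q \<gamma> t0 s0 \<longrightarrow>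
      monotone_reparam_of \<gamma> t0 s0 (min_path p q) 0 1) \<and>
    (\<forall>\<gamma> t0 s0. path_from_to p q \<gamma> t0 s0 \<longrightarrow>
      finsler_length (conformal_finsler f) (min_path p q) 0 1
        \<le> finsler_length (conformal_finsler f) \<gamma> t0 s0 \<and>
      (finsler_length (conformal_finsler f) (min_path p q) 0 1
          = finsler_length (conformal_finsler f) \<gamma> t0 s0
        \<longleftrightarrow> monotone_reparam_of \<gamma> t0 s0 (min_path p q) 0 1))"
proof -
  obtain k where "hex_plane f k"
    by (rule trapezoid_hex_plane[OF assms(1-4,6,7)])
  then interpret hex_plane f k .
  obtain v w A B where bent: "is_bent_path p q (min_path p q) v w A B"
    by (rule min_path_is_bent_path)
  let ?len = "finsler_length (conformal_finsler f)"
  have path: "path_from_to p q (min_path p q) 0 1"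
    unfolding path_from_to_def
    by (intro conjI piecewise_smooth_min_path bent_path_ends[OF bent])
  \<comment> \<open>The length of \<open>min_path\<close> itself is the case of the identity
    parameter change.\<close>
  have "monotone_reparam_of (min_path p q) 0 1 (min_path p q) 0 1"
    unfolding monotone_reparam_of_def
    by (intro exI[of _ "\<lambda>t. t"]) (auto intro: mono_onI)
  then have len: "?len (min_path p q) 0 1 = bent_dist f p q"
    by (rule length_of_reparam[OF bent cont piecewise_smooth_min_path])
  have ge: "bent_dist f p q \<le> ?len \<gamma> t0 s0" if "path_from_to p q \<gamma> t0 s0" for \<gamma> t0 s0
  proof -
    have "piecewise_smooth \<gamma> t0 s0" "\<gamma> t0 = p" "\<gamma> s0 = q" "t0 < s0"
      using that unfolding path_from_to_def piecewise_smooth_def by auto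
    then show ?thesis
      using bent_dist_le_length[of \<gamma> t0 s0 t0 s0 p] by (simp add: finsler_length_def)
  qed
  have dist: "finsler_dist (conformal_finsler f) p q = bent_dist f p q"
    unfolding finsler_dist_def
    by (rule cInf_eq_minimum) (use path len ge in \<open>auto intro: sym\<close>)
  have eq_iff: "?len \<gamma> t0 s0 = bent_dist f p q \<longleftrightarrow> monotone_reparam_of \<gamma> t0 s0 (min_path p q) 0 1"
    if "path_from_to p q \<gamma> t0 s0" for \<gamma> t0 s0
  proof
    assume "?len \<gamma> t0 s0 = bent_dist f p q"
    then show "monotone_reparam_of \<gamma> t0 s0 (min_path p q) 0 1"
      by (rule minimal_imp_reparam[OF bent that])
  next
    assume "monotone_reparam_of \<gamma> t0 s0 (min_path p q) 0 1"
    moreover have "piecewise_smooth \<gamma> t0 s0" using that unfolding path_from_to_def by simp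
    ultimately show "?len \<gamma> t0 s0 = bent_dist f p q"
      using length_of_reparam[OF bent cont] by simp
  qed
  show ?thesis
  proof (intro conjI allI impI)
    show "minimizing_path (conformal_finsler f) p q (min_path p q) 0 1"
      unfolding minimizing_path_def using path len dist by simp
    show "monotone_reparam_of \<gamma> t0 s0 (min_path p q) 0 1"
      if "minimizing_path (conformal_finsler f) p q \<gamma> t0 s0" for \<gamma> t0 s0
      using that eq_iff[of \<gamma> t0 s0] dist unfolding minimizing_path_def by simp
    fix \<gamma> :: "real \<Rightarrow> plane" and t0 s0 assume \<gamma>: "path_from_to p q \<gamma> t0 s0"
    show "?len (min_path p q) 0 1 \<le> ?len \<gamma> t0 s0" using ge[OF \<gamma>] len by simp
    show "?len (min_path p q) 0 1 = ?len \<gamma> t0 s0 \<longleftrightarrow> monotone_reparam_of \<gamma> t0 s0 (min_path p q) 0 1"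
      using eq_iff[OF \<gamma>] len by (simp add: eq_commute)
  qed
qed

end
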